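(* Let $(T_1,T_2,T)$ be a pure $\mathbb E$-contraction on a Hilbert space $\mathcal H$ and let the fundamental operators $A_{1*},A_{2*}$ of $(T_1^*,T_2^*,T^* )$ be commuting operators satisfying $[A_{1*}^*,A_{1*}]=[A_{2*}^*,A_{2*}]$. Then $(T_1,T_2,T)$ is unitarily equivalent (by a single unitary) to the triple $(R_1,R_2,R)$ on the Hilbert space $$\mathbb H_T=(H^2(\mathbb D)\otimes\mathcal D_{T^*})\ominus M_{\Theta_T}(H^2(\mathbb D)\otimes\mathcal D_T)$$ defined by $$R_1=P_{\mathbb H_T}(I\otimes A_{1*}^*+M_z\otimes A_{2*})|_{\mathbb H_T},\quad R_2=P_{\mathbb H_T}(I\otimes A_{2*}^*+M_z\otimes A_{1*})|_{\mathbb H_T},\quad R=P_{\mathbb H_T}(M_z\otimes I)|_{\mathbb H_T}.$$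
   Context: The tetrablock is $\mathbb E=\{(x_1,x_2,x_3)\in\mathbb C^3: 1-zx_1-wx_2+zwx_3\ne0 \text{ whenever } |z|\le1,|w|\le1\}$. A commuting triple $(T_1,T_2,T_3)$ of bounded Hilbert space operators is an $\mathbb E$-contraction if its Taylor joint spectrum lies in $\overline{\mathbb E}$ and $\|p(T_1,T_2,T_3)\|\le\sup_{\overline{\mathbb E}}|p|$ for every polynomial $p$ in three variables; the adjoint triple is then also an $\mathbb E$-contraction. It is pure if $(T_3^* )^n\to0$ strongly. For a contraction $T$, $D_T=(I-T^*T)^{1/2}$, $\mathcal D_T=\overline{\mathrm{Ran}}\,D_T$. The fundamental operators of an $\mathbb E$-contraction $(S_1,S_2,S_3)$ are the unique bounded operators $A_1,A_2$ on $\mathcal D_{S_3}$ with $S_1-S_2^*S_3=D_{S_3}A_1D_{S_3}$ and $S_2-S_1^*S_3=D_{S_3}A_2D_{S_3}$ (they are known to exist). The characteristic function of a contraction $T$ is $\Theta_T(z)=[-T+zD_{T^*}(I-zT^* )^{-1}D_T]|_{\mathcal D_T}:\mathcal D_T\to\mathcal D_{T^*}$ for $z\in\mathbb D$, and $M_{\Theta_T}:H^2(\mathbb D)\otimes\mathcal D_T\to H^2(\mathbb D)\otimes\mathcal D_{T^*}$ is the corresponding multiplication operator. $H^2(\mathbb D)$ is the Hardy space of the unit disc, $M_z$ is multiplication by $z$ on it, $P_{\mathbb H_T}$ is the orthogonal projection onto $\mathbb H_T$, and $[S_1,S_2]=S_1S_2-S_2S_1$. *)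

theory Defs
  imports "HOL-Analysis.Analysis"
begin

section \<open>Complex Hilbert spaces\<close>

class complex_vector = real_vector +
  fixes scaleC :: "complex \<Rightarrow> 'a \<Rightarrow> 'a"  (infixr "*\<^sub>C" 75)
  assumes scaleC_add_right: "c *\<^sub>C (x + y) = c *\<^sub>C x + c *\<^sub>C y"
    and scaleC_add_left: "(c + d) *\<^sub>C x = c *\<^sub>C x + d *\<^sub>C x"
    and scaleC_scaleC: "c *\<^sub>C d *\<^sub>C x = (c * d) *\<^sub>C x"
    and scaleC_of_real: "complex_of_real r *\<^sub>C x = r *\<^sub>R x"

text \<open>The inner product is linear in the first argument; its real part is the library's real
  inner product, which determines norm and topology.\<close>

class complex_inner = complex_vector + real_inner +
  fixes cinner :: "'a \<Rightarrow> 'a \<Rightarrow> complex"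
  assumes cinner_commute: "cinner x y = cnj (cinner y x)"
    and cinner_add_left: "cinner (x + y) z = cinner x z + cinner y z"
    and cinner_scaleC_left: "cinner (c *\<^sub>C x) y = c * cinner x y"
    and Re_cinner: "Re (cinner x y) = inner x y"

class chilbert_space = complex_inner + complete_space

subclass (in chilbert_space) banach ..

lemma scaleC_one [simp]: "1 *\<^sub>C x = (x :: 'a::complex_vector)"
  using scaleC_of_real[of 1 x] by simp

lemma scaleC_zero_left [simp]: "0 *\<^sub>C x = (0 :: 'a::complex_vector)"
  using scaleC_of_real[of 0 x] by simp

lemma scaleC_zero_right [simp]: "c *\<^sub>C 0 = (0 :: 'a::complex_vector)"
  using scaleC_add_right[of c 0 "0 :: 'a"] by simp

lemma cinner_self: "cinner x x = complex_of_real ((norm x)\<^sup>2)" for x :: "'a::complex_inner"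
proof -
  have "Im (cinner x x) = - Im (cinner x x)"
    by (subst (1) cinner_commute) simp
  then show ?thesis
    by (simp add: complex_eq_iff Re_cinner power2_norm_eq_inner)
qed

lemma norm_scaleC: "norm (c *\<^sub>C x) = norm c * norm x" for x :: "'a::complex_inner"
proof -
  have "cinner (c *\<^sub>C x) (c *\<^sub>C x) = c * cnj c * cinner x x"
    by (subst cinner_scaleC_left, subst cinner_commute, subst cinner_scaleC_left)
      (simp add: cinner_self)
  then have "complex_of_real ((norm (c *\<^sub>C x))\<^sup>2) = complex_of_real ((norm c * norm x)\<^sup>2)"
    by (simp add: cinner_self complex_mult_cnj cmod_power2 power_mult_distrib)
  then have "(norm (c *\<^sub>C x))\<^sup>2 = (norm c * norm x)\<^sup>2"
    using of_real_eq_iff by blast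
  then show ?thesis
    by (simp add: power2_eq_iff_nonneg)
qed

lemma norm_cinner_le: "norm (cinner x y) \<le> norm x * norm y" for x y :: "'a::complex_inner"
proof (cases "cinner x y = 0")
  case False
  define c where "c = cnj (cinner x y) / norm (cinner x y)"
  have nc: "norm c = 1"
    using False by (simp add: c_def norm_divide)
  have "cinner (c *\<^sub>C x) y = complex_of_real (norm (cinner x y))"
    using False
    by (simp add: cinner_scaleC_left c_def mult.commute[of "cnj _"] complex_norm_square[symmetric]
        power2_eq_square)
  then have "norm (cinner x y) = inner (c *\<^sub>C x) y"
    by (metis Re_complex_of_real Re_cinner)
  also have "\<dots> \<le> norm (c *\<^sub>C x) * norm y"
    by (rule norm_cauchy_schwarz)
  finally show ?thesis
    by (simp add: norm_scaleC nc)
qed simp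

section \<open>Operators on a Hilbert space and on its closed subspaces\<close>

text \<open>Hilbert spaces such as the defect spaces occur as closed subspaces of a type; an operator on
  such a subspace \<open>E\<close> is a function on the type of which only the values on \<open>E\<close> matter.\<close>

definition bounded_clinear_on :: "'a::complex_inner set \<Rightarrow> ('a \<Rightarrow> 'a) \<Rightarrow> bool" where
  "bounded_clinear_on E A \<longleftrightarrow>
     (\<forall>x\<in>E. A x \<in> E) \<and>
     (\<forall>x\<in>E. \<forall>y\<in>E. A (x + y) = A x + A y) \<and>
     (\<forall>c. \<forall>x\<in>E. A (c *\<^sub>C x) = c *\<^sub>C A x) \<and>
     (\<exists>K. \<forall>x\<in>E. norm (A x) \<le> K * norm x)"

abbreviation bounded_clinear :: "('a::complex_inner \<Rightarrow> 'a) \<Rightarrow> bool" where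
  "bounded_clinear \<equiv> bounded_clinear_on UNIV"

definition adj_on :: "'a::complex_inner set \<Rightarrow> ('a \<Rightarrow> 'a) \<Rightarrow> 'a \<Rightarrow> 'a" where
  "adj_on E A y = (THE w. w \<in> E \<and> (\<forall>x\<in>E. cinner (A x) y = cinner x w))"

abbreviation adj :: "('a::complex_inner \<Rightarrow> 'a) \<Rightarrow> 'a \<Rightarrow> 'a" where
  "adj \<equiv> adj_on UNIV"

definition commutator :: "('a \<Rightarrow> 'a) \<Rightarrow> ('a \<Rightarrow> 'a) \<Rightarrow> 'a \<Rightarrow> 'a::ab_group_add" where
  "commutator A B x = A (B x) - B (A x)"

definition positive_op :: "('a::complex_inner \<Rightarrow> 'a) \<Rightarrow> bool" where
  "positive_op P \<longleftrightarrow> bounded_clinear P \<and>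
     (\<forall>x. Im (cinner (P x) x) = 0 \<and> 0 \<le> Re (cinner (P x) x))"

definition sqrt_op :: "('a::complex_inner \<Rightarrow> 'a) \<Rightarrow> 'a \<Rightarrow> 'a" where
  "sqrt_op P = (THE Q. positive_op Q \<and> Q \<circ> Q = P)"

definition orth_proj :: "'a::complex_inner set \<Rightarrow> 'a \<Rightarrow> 'a" where
  "orth_proj S x = (THE y. y \<in> S \<and> (\<forall>s\<in>S. cinner (x - y) s = 0))"

definition orth_diff :: "'a::complex_inner set \<Rightarrow> 'a set \<Rightarrow> 'a set"  (infixl "\<ominus>" 65) where
  "S \<ominus> R = {x \<in> S. \<forall>y\<in>R. cinner x y = 0}"

definition unitary_between ::
  "'a::complex_inner set \<Rightarrow> 'b::complex_inner set \<Rightarrow> ('a \<Rightarrow> 'b) \<Rightarrow> bool" where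
  "unitary_between X Y U \<longleftrightarrow>
     (\<forall>x\<in>X. \<forall>y\<in>X. U (x + y) = U x + U y) \<and>
     (\<forall>c. \<forall>x\<in>X. U (c *\<^sub>C x) = c *\<^sub>C U x) \<and>
     (\<forall>x\<in>X. \<forall>y\<in>X. cinner (U x) (U y) = cinner x y) \<and>
     U ` X = Y"

definition unitarily_equivalent3 ::
  "'a::complex_inner set \<Rightarrow> ('a \<Rightarrow> 'a) \<times> ('a \<Rightarrow> 'a) \<times> ('a \<Rightarrow> 'a) \<Rightarrow>
   'b::complex_inner set \<Rightarrow> ('b \<Rightarrow> 'b) \<times> ('b \<Rightarrow> 'b) \<times> ('b \<Rightarrow> 'b) \<Rightarrow> bool" where
  "unitarily_equivalent3 X = (\<lambda>(S1, S2, S3) Y (R1, R2, R3).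
     \<exists>U. unitary_between X Y U \<and>
       (\<forall>x\<in>X. U (S1 x) = R1 (U x) \<and> U (S2 x) = R2 (U x) \<and> U (S3 x) = R3 (U x)))"

section \<open>Tetrablock contractions\<close>

definition tetrablock :: "(complex \<times> complex \<times> complex) set" where
  "tetrablock = {(x1, x2, x3). \<forall>z w. norm z \<le> 1 \<and> norm w \<le> 1 \<longrightarrow>
     1 - z * x1 - w * x2 + z * w * x3 \<noteq> 0}"

text \<open>Exactness at every spot of the Koszul complex
  \<open>0 \<rightarrow> H \<rightarrow> H\<^sup>3 \<rightarrow> H\<^sup>3 \<rightarrow> H \<rightarrow> 0\<close> of a commuting triple; the
  coordinates of the second \<open>H\<^sup>3\<close> are those of \<open>e1\<and>e2\<close>, \<open>e1\<and>e3\<close>, \<open>e2\<and>e3\<close>.\<close>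

definition koszul_exact ::
  "('a::ab_group_add \<Rightarrow> 'a) \<Rightarrow> ('a \<Rightarrow> 'a) \<Rightarrow> ('a \<Rightarrow> 'a) \<Rightarrow> bool" where
  "koszul_exact B1 B2 B3 \<longleftrightarrow>
    (let d0 = (\<lambda>x. (B1 x, B2 x, B3 x));
         d1 = (\<lambda>(x1, x2, x3). (B1 x2 - B2 x1, B1 x3 - B3 x1, B2 x3 - B3 x2));
         d2 = (\<lambda>(y12, y13, y23). B1 y23 - B2 y13 + B3 y12)
     in {x. d0 x = 0} = {0} \<and> {u. d1 u = 0} = range d0 \<and> {v. d2 v = 0} = range d1 \<and>
        range d2 = UNIV)"

definition taylor_spectrum ::
  "('a::complex_vector \<Rightarrow> 'a) \<Rightarrow> ('a \<Rightarrow> 'a) \<Rightarrow> ('a \<Rightarrow> 'a) \<Rightarrow> (complex \<times> complex \<times> complex) set" where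
  "taylor_spectrum S1 S2 S3 = {(l1, l2, l3).
     \<not> koszul_exact (\<lambda>x. S1 x - l1 *\<^sub>C x) (\<lambda>x. S2 x - l2 *\<^sub>C x) (\<lambda>x. S3 x - l3 *\<^sub>C x)}"

text \<open>Every polynomial in three variables has the form
  \<open>\<Sum>i,j,k\<le>N. c i j k x1\<^sup>i x2\<^sup>j x3\<^sup>k\<close> for some \<open>N\<close> and \<open>c\<close>.\<close>

definition poly3 :: "nat \<Rightarrow> (nat \<Rightarrow> nat \<Rightarrow> nat \<Rightarrow> complex) \<Rightarrow> complex \<times> complex \<times> complex \<Rightarrow> complex" where
  "poly3 N c = (\<lambda>(x1, x2, x3). \<Sum>i\<le>N. \<Sum>j\<le>N. \<Sum>k\<le>N. c i j k * x1 ^ i * x2 ^ j * x3 ^ k)"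

definition poly3_op :: "nat \<Rightarrow> (nat \<Rightarrow> nat \<Rightarrow> nat \<Rightarrow> complex) \<Rightarrow>
    ('a::complex_vector \<Rightarrow> 'a) \<Rightarrow> ('a \<Rightarrow> 'a) \<Rightarrow> ('a \<Rightarrow> 'a) \<Rightarrow> 'a \<Rightarrow> 'a" where
  "poly3_op N c S1 S2 S3 x =
     (\<Sum>i\<le>N. \<Sum>j\<le>N. \<Sum>k\<le>N. c i j k *\<^sub>C (S1 ^^ i) ((S2 ^^ j) ((S3 ^^ k) x)))"

definition E_contraction :: "('a::chilbert_space \<Rightarrow> 'a) \<Rightarrow> ('a \<Rightarrow> 'a) \<Rightarrow> ('a \<Rightarrow> 'a) \<Rightarrow> bool" where
  "E_contraction S1 S2 S3 \<longleftrightarrow>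
     bounded_clinear S1 \<and> bounded_clinear S2 \<and> bounded_clinear S3 \<and>
     S1 \<circ> S2 = S2 \<circ> S1 \<and> S1 \<circ> S3 = S3 \<circ> S1 \<and> S2 \<circ> S3 = S3 \<circ> S2 \<and>
     taylor_spectrum S1 S2 S3 \<subseteq> closure tetrablock \<and>
     (\<forall>N c. onorm (poly3_op N c S1 S2 S3) \<le> (SUP x\<in>closure tetrablock. norm (poly3 N c x)))"

definition pure_E_contraction :: "('a::chilbert_space \<Rightarrow> 'a) \<Rightarrow> ('a \<Rightarrow> 'a) \<Rightarrow> ('a \<Rightarrow> 'a) \<Rightarrow> bool" where
  "pure_E_contraction S1 S2 S3 \<longleftrightarrow>
     E_contraction S1 S2 S3 \<and> (\<forall>x. (\<lambda>n. (adj S3 ^^ n) x) \<longlonglongrightarrow> 0)"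

definition defect_op :: "('a::complex_inner \<Rightarrow> 'a) \<Rightarrow> 'a \<Rightarrow> 'a" where
  "defect_op S = sqrt_op (\<lambda>x. x - adj S (S x))"

definition defect_space :: "('a::complex_inner \<Rightarrow> 'a) \<Rightarrow> 'a set" where
  "defect_space S = closure (range (defect_op S))"

definition fundamental_operators :: "('a::complex_inner \<Rightarrow> 'a) \<Rightarrow> ('a \<Rightarrow> 'a) \<Rightarrow> ('a \<Rightarrow> 'a) \<Rightarrow>
    ('a \<Rightarrow> 'a) \<Rightarrow> ('a \<Rightarrow> 'a) \<Rightarrow> bool" where
  "fundamental_operators S1 S2 S3 A1 A2 \<longleftrightarrow>
     bounded_clinear_on (defect_space S3) A1 \<and> bounded_clinear_on (defect_space S3) A2 \<and>
     (\<forall>x. S1 x - adj S2 (S3 x) = defect_op S3 (A1 (defect_op S3 x))) \<and>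
     (\<forall>x. S2 x - adj S1 (S3 x) = defect_op S3 (A2 (defect_op S3 x)))"

section \<open>The vector-valued Hardy space of the unit disc\<close>

text \<open>Functions on the disc are extended by zero.\<close>

definition disc_series :: "(nat \<Rightarrow> 'a::{complex_vector,real_normed_vector}) \<Rightarrow> (complex \<Rightarrow> 'a) \<Rightarrow> bool"
  where "disc_series a f \<longleftrightarrow>
    (\<forall>z. norm z < 1 \<longrightarrow> (\<lambda>n. z ^ n *\<^sub>C a n) sums f z) \<and> (\<forall>z. \<not> norm z < 1 \<longrightarrow> f z = 0)"

definition square_summable :: "(nat \<Rightarrow> 'a::real_normed_vector) \<Rightarrow> bool" where
  "square_summable a \<longleftrightarrow> summable (\<lambda>n. (norm (a n))\<^sup>2)"

lemma square_summable_add: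
  assumes "square_summable a" "square_summable b"
  shows "square_summable (\<lambda>n. a n + b n)"
  unfolding square_summable_def
proof (rule summable_comparison_test'[where N = 0])
  show "summable (\<lambda>n. 2 * (norm (a n))\<^sup>2 + 2 * (norm (b n))\<^sup>2)"
    using assms unfolding square_summable_def by (intro summable_add summable_mult)
  fix n
  have "(norm (a n + b n))\<^sup>2 \<le> (norm (a n) + norm (b n))\<^sup>2"
    by (simp add: norm_triangle_ineq power_mono)
  also have "\<dots> \<le> 2 * (norm (a n))\<^sup>2 + 2 * (norm (b n))\<^sup>2"
    using sum_squares_bound[of "norm (a n)" "norm (b n)"] by (simp add: power2_sum)
  finally show "norm ((norm (a n + b n))\<^sup>2) \<le> 2 * (norm (a n))\<^sup>2 + 2 * (norm (b n))\<^sup>2"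
    by simp
qed

lemma square_summable_scaleC:
  "square_summable a \<Longrightarrow> square_summable (\<lambda>n. c *\<^sub>C (a n :: 'a::complex_inner))"
  unfolding square_summable_def by (simp add: norm_scaleC power_mult_distrib summable_mult)

lemma square_summable_ex_disc_series:
  fixes a :: "nat \<Rightarrow> 'a::chilbert_space"
  assumes "square_summable a"
  shows "\<exists>f. disc_series a f"
proof -
  have "(\<lambda>n. (norm (a n))\<^sup>2) \<longlonglongrightarrow> 0"
    using assms unfolding square_summable_def by (rule summable_LIMSEQ_zero)
  then have "Bseq (\<lambda>n. (norm (a n))\<^sup>2)"
    using convergentI convergent_imp_Bseq by blast
  then obtain K where K: "0 < K" "\<And>n. (norm (a n))\<^sup>2 \<le> K"
    unfolding Bseq_def by auto
  have "summable (\<lambda>n. z ^ n *\<^sub>C a n)" if "norm z < 1" for z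
  proof (rule summable_comparison_test'[where N = 0])
    show "summable (\<lambda>n. sqrt K * norm z ^ n)"
      using that by (intro summable_mult summable_geometric) simp
    show "norm (z ^ n *\<^sub>C a n) \<le> sqrt K * norm z ^ n" for n
      using K(2)[of n] real_le_rsqrt
      by (simp add: norm_scaleC norm_power mult.commute mult_right_mono)
  qed
  then have "disc_series a (\<lambda>z. if norm z < 1 then \<Sum>n. z ^ n *\<^sub>C a n else 0)"
    unfolding disc_series_def by (auto intro: summable_sums)
  then show ?thesis by blast
qed

lemma powser_real_zero:
  fixes a :: "nat \<Rightarrow> real"
  assumes "\<And>x. \<bar>x\<bar> < 1 \<Longrightarrow> (\<lambda>n. a n * x ^ n) sums 0"
  shows "a n = 0"
proof (induction n rule: less_induct)
  case (less n)
  have *: "(\<lambda>k. a (k + n) * x ^ k) sums 0" if x: "x \<noteq> 0" "norm x < 1" for x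
  proof -
    have "(\<lambda>k. a (k + n) * x ^ (k + n)) sums (0 - (\<Sum>i<n. a i * x ^ i))"
      using assms[of x] x by (intro sums_split_initial_segment) auto
    then have "(\<lambda>k. a (k + n) * x ^ (k + n)) sums 0"
      using less by simp
    then have "(\<lambda>k. a (k + n) * x ^ (k + n) / x ^ n) sums (0 / x ^ n)"
      by (rule sums_divide)
    then show ?thesis
      using x by (simp add: power_add)
  qed
  have "((\<lambda>x. 0) \<longlongrightarrow> a (0 + n)) (at (0::real))"
    by (rule powser_limit_0_strong[where s = 1]) (use * in auto)
  then show ?case
    by (simp add: tendsto_const_iff)
qed

lemma disc_series_unique:
  fixes a b :: "nat \<Rightarrow> 'a::complex_inner"
  assumes "disc_series a f" "disc_series b f"
  shows "a = b"
proof
  fix n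
  have "inner (a n - b n) v = 0" for v
  proof (rule powser_real_zero[where a = "\<lambda>n. inner (a n - b n) v"])
    fix x :: real
    assume x: "\<bar>x\<bar> < 1"
    have "(\<lambda>n. x ^ n *\<^sub>R a n) sums f (of_real x)" "(\<lambda>n. x ^ n *\<^sub>R b n) sums f (of_real x)"
      using assms[unfolded disc_series_def] x
      by (auto simp flip: scaleC_of_real dest!: spec[where x = "complex_of_real x"])
    from sums_diff[OF this] have "(\<lambda>n. x ^ n *\<^sub>R (a n - b n)) sums 0"
      by (simp add: scaleR_diff_right)
    from bounded_linear.sums[OF bounded_linear_inner_left this, of v]
    show "(\<lambda>n. inner (a n - b n) v * x ^ n) sums 0"
      by (simp add: mult.commute)
  qed
  then show "a n = b n"
    by (metis inner_eq_zero_iff right_minus_eq)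
qed

typedef (overloaded) ('a::chilbert_space) hardy =
  "{f :: complex \<Rightarrow> 'a. \<exists>a. square_summable a \<and> disc_series a f}"
  morphisms hardy_fun Hardy
proof
  show "(\<lambda>_. 0) \<in> {f :: complex \<Rightarrow> 'a. \<exists>a. square_summable a \<and> disc_series a f}"
    by (auto intro!: exI[of _ "\<lambda>_. 0"]
        simp: square_summable_def disc_series_def)
qed

definition taylor :: "'a::chilbert_space hardy \<Rightarrow> nat \<Rightarrow> 'a" where
  "taylor f = (THE a. disc_series a (hardy_fun f))"

lemma taylor_eqI: "disc_series a (hardy_fun f) \<Longrightarrow> taylor f = a"
  unfolding taylor_def using disc_series_unique by blast

lemma disc_series_taylor: "disc_series (taylor f) (hardy_fun f)"
  and square_summable_taylor: "square_summable (taylor f)"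
  using hardy_fun[of f] taylor_eqI by auto

lemma ex_hardy:
  assumes "square_summable a"
  shows "\<exists>f. taylor f = a"
proof -
  obtain g where "disc_series a g"
    using square_summable_ex_disc_series[OF assms] ..
  moreover from this have "hardy_fun (Hardy g) = g"
    using assms by (intro Hardy_inverse) auto
  ultimately have "taylor (Hardy g) = a"
    by (intro taylor_eqI) simp
  then show ?thesis ..
qed

lemma taylor_inject: "taylor f = taylor g \<longleftrightarrow> f = g"
proof
  assume "taylor f = taylor g"
  then have "disc_series (taylor f) (hardy_fun f)" "disc_series (taylor f) (hardy_fun g)"
    using disc_series_taylor by metis+
  then have "hardy_fun f z = hardy_fun g z" for z
    unfolding disc_series_def by (cases "norm z < 1") (auto dest: sums_unique2)
  then show "f = g"
    using hardy_fun_inject by blast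
qed simp

lemma disc_series_add:
  "disc_series a f \<Longrightarrow> disc_series b g \<Longrightarrow> disc_series (\<lambda>n. a n + b n) (\<lambda>z. f z + g z)"
  unfolding disc_series_def by (auto simp: scaleC_add_right intro: sums_add)

lemma bounded_linear_scaleC: "bounded_linear (\<lambda>x :: 'a::complex_inner. c *\<^sub>C x)"
  by (rule bounded_linear_intro[where K = "norm c"])
    (simp_all add: scaleC_add_right norm_scaleC mult.commute scaleC_scaleC flip: scaleC_of_real)

lemma disc_series_scaleC:
  fixes f :: "complex \<Rightarrow> 'a::complex_inner"
  assumes "disc_series a f"
  shows "disc_series (\<lambda>n. c *\<^sub>C a n) (\<lambda>z. c *\<^sub>C f z)"
proof -
  have "z ^ n *\<^sub>C c *\<^sub>C a n = c *\<^sub>C z ^ n *\<^sub>C a n" for z n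
    by (simp add: scaleC_scaleC mult.commute)
  moreover have "u sums x \<Longrightarrow> (\<lambda>n. c *\<^sub>C u n) sums (c *\<^sub>C x)" for u and x :: 'a
    by (rule bounded_linear.sums[OF bounded_linear_scaleC])
  ultimately show ?thesis
    using assms unfolding disc_series_def by simp
qed

lemma summable_cinner:
  fixes a b :: "nat \<Rightarrow> 'a::complex_inner"
  assumes "square_summable a" "square_summable b"
  shows "summable (\<lambda>n. cinner (a n) (b n))"
proof (rule summable_comparison_test'[where N = 0])
  show "summable (\<lambda>n. (norm (a n))\<^sup>2 + (norm (b n))\<^sup>2)"
    using assms unfolding square_summable_def by (rule summable_add)
  fix n
  have "norm (a n) * norm (b n) \<le> (norm (a n))\<^sup>2 + (norm (b n))\<^sup>2"
    using sum_squares_bound[of "norm (a n)" "norm (b n)"]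
      mult_nonneg_nonneg[OF norm_ge_zero norm_ge_zero, of "a n" "b n"] by linarith
  then show "norm (cinner (a n) (b n)) \<le> (norm (a n))\<^sup>2 + (norm (b n))\<^sup>2"
    using norm_cinner_le order_trans by blast
qed

instantiation hardy :: (chilbert_space) complex_inner
begin

definition "0 = Hardy (\<lambda>_. 0)"
definition "f + g = Hardy (\<lambda>z. hardy_fun f z + hardy_fun g z)"
definition "- f = Hardy (\<lambda>z. - hardy_fun f z)" for f :: "'a hardy"
definition "f - g = Hardy (\<lambda>z. hardy_fun f z - hardy_fun g z)"
definition "r *\<^sub>R f = Hardy (\<lambda>z. r *\<^sub>R hardy_fun f z)"
definition "c *\<^sub>C f = Hardy (\<lambda>z. c *\<^sub>C hardy_fun f z)"
definition "cinner f g = (\<Sum>n. cinner (taylor f n) (taylor g n))"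
definition "inner f g = Re (cinner f g)" for f g :: "'a hardy"
definition "norm f = sqrt (inner f f)" for f :: "'a hardy"
definition "sgn f = inverse (norm f) *\<^sub>R f" for f :: "'a hardy"
definition "dist f g = norm (f - g)" for f g :: "'a hardy"
definition [code del]: "(uniformity :: ('a hardy \<times> 'a hardy) filter) =
  (INF e\<in>{0 <..}. principal {(f, g). dist f g < e})"
definition [code del]: "open U \<longleftrightarrow>
  (\<forall>f\<in>U. \<forall>\<^sub>F (f', g) in uniformity. f' = f \<longrightarrow> g \<in> U)" for U :: "'a hardy set"

lemma hardy_fun_zero: "hardy_fun (0 :: 'a hardy) = (\<lambda>_. 0)"
  unfolding zero_hardy_def
  by (rule Hardy_inverse)
    (auto intro!: exI[of _ "\<lambda>_. 0"] simp: square_summable_def disc_series_def)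

lemma hardy_fun_add: "hardy_fun (f + g) = (\<lambda>z. hardy_fun f z + hardy_fun g z)"
  unfolding plus_hardy_def
  by (rule Hardy_inverse)
    (use square_summable_add disc_series_add square_summable_taylor disc_series_taylor in blast)

lemma hardy_fun_scaleC: "hardy_fun (c *\<^sub>C f) = (\<lambda>z. c *\<^sub>C hardy_fun f z)"
  unfolding scaleC_hardy_def
  by (rule Hardy_inverse)
    (use square_summable_scaleC disc_series_scaleC square_summable_taylor disc_series_taylor in blast)

lemma scaleR_hardy: "r *\<^sub>R f = complex_of_real r *\<^sub>C f" for f :: "'a hardy"
  by (simp add: scaleR_hardy_def scaleC_hardy_def scaleC_of_real)

lemma hardy_fun_scaleR: "hardy_fun (r *\<^sub>R f) = (\<lambda>z. r *\<^sub>R hardy_fun f z)"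
  by (simp add: scaleR_hardy hardy_fun_scaleC scaleC_of_real)

lemma uminus_hardy: "- f = (- 1) *\<^sub>R f" for f :: "'a hardy"
  by (simp add: uminus_hardy_def scaleR_hardy_def)

lemma hardy_fun_uminus: "hardy_fun (- f) = (\<lambda>z. - hardy_fun f z)"
  by (simp add: uminus_hardy hardy_fun_scaleR)

lemma minus_hardy: "f - g = f + (- g)" for f g :: "'a hardy"
  by (simp add: minus_hardy_def plus_hardy_def hardy_fun_uminus)

lemma taylor_zero: "taylor (0 :: 'a hardy) = (\<lambda>_. 0)"
  by (rule taylor_eqI) (simp add: hardy_fun_zero disc_series_def)

lemma taylor_add: "taylor (f + g) = (\<lambda>n. taylor f n + taylor g n)"
  by (rule taylor_eqI) (simp add: hardy_fun_add disc_series_add disc_series_taylor)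

lemma taylor_scaleC: "taylor (c *\<^sub>C f) = (\<lambda>n. c *\<^sub>C taylor f n)"
  by (rule taylor_eqI) (simp add: hardy_fun_scaleC disc_series_scaleC disc_series_taylor)

lemma summable_cinner_taylor: "summable (\<lambda>n. cinner (taylor f n) (taylor g n))"
  by (intro summable_cinner square_summable_taylor)

lemma inner_hardy_self: "inner f f = (\<Sum>n. (norm (taylor f n))\<^sup>2)" for f :: "'a hardy"
  using bounded_linear.suminf[OF bounded_linear_Re summable_cinner_taylor[of f f]]
  by (simp add: inner_hardy_def cinner_hardy_def cinner_self)

lemma cinner_commute_hardy: "cinner f g = cnj (cinner g f)" for f g :: "'a hardy"
  using bounded_linear.suminf[OF bounded_linear_cnj summable_cinner_taylor[of g f]]
    cinner_commute[of "taylor f _" "taylor g _"]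
  by (simp add: cinner_hardy_def)

lemma cinner_add_left_hardy: "cinner (f + g) h = cinner f h + cinner g h" for f g h :: "'a hardy"
  by (simp add: cinner_hardy_def taylor_add cinner_add_left suminf_add summable_cinner_taylor)

lemma cinner_scaleC_left_hardy: "cinner (c *\<^sub>C f) g = c * cinner f g" for f g :: "'a hardy"
  by (simp add: cinner_hardy_def taylor_scaleC cinner_scaleC_left suminf_mult
      summable_cinner_taylor)

instance
proof
  fix f g h :: "'a hardy" and r s :: real and c d :: complex
  show "f + g + h = f + (g + h)" "f + g = g + f" "0 + f = f" "- f + f = 0"
    by (simp_all flip: hardy_fun_inject
        add: hardy_fun_add hardy_fun_zero hardy_fun_uminus ac_simps)
  show "f - g = f + - g"
    by (rule minus_hardy)
  show "r *\<^sub>R (f + g) = r *\<^sub>R f + r *\<^sub>R g" "(r + s) *\<^sub>R f = r *\<^sub>R f + s *\<^sub>R f"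
    "r *\<^sub>R s *\<^sub>R f = (r * s) *\<^sub>R f" "1 *\<^sub>R f = f"
    by (simp_all flip: hardy_fun_inject add: hardy_fun_add hardy_fun_scaleR algebra_simps)
  show "c *\<^sub>C (f + g) = c *\<^sub>C f + c *\<^sub>C g" "(c + d) *\<^sub>C f = c *\<^sub>C f + d *\<^sub>C f"
    "c *\<^sub>C d *\<^sub>C f = (c * d) *\<^sub>C f" "complex_of_real r *\<^sub>C f = r *\<^sub>R f"
    by (simp_all flip: hardy_fun_inject add: hardy_fun_add hardy_fun_scaleC hardy_fun_scaleR
        scaleC_add_left scaleC_add_right scaleC_scaleC scaleC_of_real)
  show "norm f = sqrt (inner f f)" "sgn f = inverse (norm f) *\<^sub>R f" "dist f g = norm (f - g)"
    "Re (cinner f g) = inner f g"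
    by (simp_all add: norm_hardy_def sgn_hardy_def dist_hardy_def inner_hardy_def)
  show "uniformity = (INF e\<in>{0 <..}. principal {(f :: 'a hardy, g). dist f g < e})"
    by (rule uniformity_hardy_def)
  show "open U \<longleftrightarrow> (\<forall>f\<in>U. \<forall>\<^sub>F (f', g) in uniformity. f' = f \<longrightarrow> g \<in> U)" for U :: "'a hardy set"
    by (rule open_hardy_def)
  show "cinner f g = cnj (cinner g f)"
    by (rule cinner_commute_hardy)
  then show "inner f g = inner g f"
    unfolding inner_hardy_def by (metis complex_cnj(1) cnj.sel(1))
  show "cinner (f + g) h = cinner f h + cinner g h" "cinner (c *\<^sub>C f) g = c * cinner f g"
    by (rule cinner_add_left_hardy cinner_scaleC_left_hardy)+
  then show "inner (f + g) h = inner f h + inner g h"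
    by (simp add: inner_hardy_def)
  show "inner (r *\<^sub>R f) g = r * inner f g"
    by (simp add: inner_hardy_def scaleR_hardy cinner_scaleC_left_hardy)
  have *: "summable (\<lambda>n. (norm (taylor f n))\<^sup>2)"
    using square_summable_taylor unfolding square_summable_def .
  then show "0 \<le> inner f f"
    by (simp add: inner_hardy_self suminf_nonneg)
  show "inner f f = 0 \<longleftrightarrow> f = 0"
    using suminf_eq_zero_iff[OF *]
    by (simp add: inner_hardy_self flip: taylor_inject) (auto simp: taylor_zero)
qed

end

lemma norm_hardy_sums: "(\<lambda>n. (norm (taylor f n))\<^sup>2) sums (norm f)\<^sup>2" for f :: "'a::chilbert_space hardy"
  using square_summable_taylor[of f]
  by (simp add: power2_norm_eq_inner inner_hardy_self square_summable_def summable_sums)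

lemma taylor_diff: "taylor (f - g) = (\<lambda>n. taylor f n - taylor g n)"
  for f g :: "'a::chilbert_space hardy"
proof -
  have "taylor f = taylor ((f - g) + g)"
    by simp
  then show ?thesis
    unfolding taylor_add by (simp add: fun_eq_iff)
qed

instance hardy :: (chilbert_space) chilbert_space
proof
  fix X :: "nat \<Rightarrow> 'a hardy"
  assume X: "Cauchy X"
  have sum_le: "(\<Sum>n<j. (norm (taylor f n))\<^sup>2) \<le> (norm f)\<^sup>2" for f :: "'a hardy" and j
    using sum_le_suminf[of "\<lambda>n. (norm (taylor f n))\<^sup>2" "{..<j}"] norm_hardy_sums[of f]
    by (simp add: sums_iff)
  have taylor_le: "norm (taylor f n) \<le> norm f" for f :: "'a hardy" and n
  proof -
    have "(norm (taylor f n))\<^sup>2 \<le> (\<Sum>k<Suc n. (norm (taylor f k))\<^sup>2)"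
      by (simp add: sum_nonneg)
    then have "(norm (taylor f n))\<^sup>2 \<le> (norm f)\<^sup>2"
      using sum_le order_trans by blast
    then show ?thesis
      by (simp add: power2_le_iff_abs_le)
  qed
  have "Cauchy (\<lambda>m. taylor (X m) n)" for n
  proof (rule metric_CauchyI)
    fix e :: real
    assume "0 < e"
    then obtain M where "\<And>m k. m \<ge> M \<Longrightarrow> k \<ge> M \<Longrightarrow> norm (X m - X k) < e"
      using CauchyD[OF X] by blast
    then show "\<exists>M. \<forall>m\<ge>M. \<forall>k\<ge>M. dist (taylor (X m) n) (taylor (X k) n) < e"
      using taylor_le[of "X _ - X _" n] unfolding taylor_diff dist_norm by (meson le_less_trans)
  qed
  then have "\<exists>l. (\<lambda>m. taylor (X m) n) \<longlonglongrightarrow> l" for n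
    by (simp add: Cauchy_convergent_iff convergent_def)
  then obtain b where b: "\<And>n. (\<lambda>m. taylor (X m) n) \<longlonglongrightarrow> b n"
    by metis
  have bound: "\<exists>M. \<forall>m\<ge>M. \<forall>j. (\<Sum>n<j. (norm (taylor (X m) n - b n))\<^sup>2) \<le> e\<^sup>2" if "0 < e" for e
  proof -
    obtain M where M: "\<And>m k. m \<ge> M \<Longrightarrow> k \<ge> M \<Longrightarrow> norm (X m - X k) < e"
      using CauchyD[OF X \<open>0 < e\<close>] by blast
    have "(\<Sum>n<j. (norm (taylor (X m) n - b n))\<^sup>2) \<le> e\<^sup>2" if "m \<ge> M" for m j
    proof (rule LIMSEQ_le_const2)
      show "(\<lambda>k. \<Sum>n<j. (norm (taylor (X m) n - taylor (X k) n))\<^sup>2)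
          \<longlonglongrightarrow> (\<Sum>n<j. (norm (taylor (X m) n - b n))\<^sup>2)"
        by (intro tendsto_intros b)
      have "(\<Sum>n<j. (norm (taylor (X m) n - taylor (X k) n))\<^sup>2) \<le> e\<^sup>2" if "k \<ge> M" for k
      proof -
        have "(norm (X m - X k))\<^sup>2 \<le> e\<^sup>2"
          using M[OF \<open>m \<ge> M\<close> that] by (intro power_mono) auto
        then show ?thesis
          using sum_le[of "X m - X k" j] by (simp add: taylor_diff)
      qed
      then show "\<exists>N. \<forall>k\<ge>N. (\<Sum>n<j. (norm (taylor (X m) n - taylor (X k) n))\<^sup>2) \<le> e\<^sup>2"
        by blast
    qed
    then show ?thesis
      by blast
  qed
  obtain M where "\<And>j. (\<Sum>n<j. (norm (taylor (X M) n - b n))\<^sup>2) \<le> 1\<^sup>2"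
    using bound[of 1] by auto
  then have "square_summable (\<lambda>n. taylor (X M) n - b n)"
    unfolding square_summable_def
    by (intro summableI_nonneg_bounded) auto
  then have "square_summable (\<lambda>n. taylor (X M) n + (- 1) *\<^sub>C (taylor (X M) n - b n))"
    by (intro square_summable_add square_summable_scaleC square_summable_taylor)
  moreover have "(- 1) *\<^sub>C x = - x" for x :: 'a
    using scaleC_of_real[of "- 1" x] by simp
  ultimately have "square_summable b"
    by simp
  then obtain L where L: "taylor L = b"
    using ex_hardy by blast
  have "X \<longlonglongrightarrow> L"
  proof (rule metric_LIMSEQ_I)
    fix r :: real
    assume "0 < r"
    then obtain M where M: "\<And>m j. m \<ge> M \<Longrightarrow> (\<Sum>n<j. (norm (taylor (X m) n - b n))\<^sup>2) \<le> (r / 2)\<^sup>2"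
      using bound[of "r / 2"] by auto
    have "dist (X m) L < r" if "m \<ge> M" for m
    proof -
      have "(norm (X m - L))\<^sup>2 \<le> (r / 2)\<^sup>2"
        using norm_hardy_sums[of "X m - L"] M[OF that]
        by (intro LIMSEQ_le_const2[OF norm_hardy_sums[unfolded sums_def]])
          (auto simp: taylor_diff L)
      then have "norm (X m - L) \<le> r / 2"
        using \<open>0 < r\<close> by (simp add: power2_le_iff_abs_le)
      then show ?thesis
        using \<open>0 < r\<close> by (simp add: dist_norm)
    qed
    then show "\<exists>M. \<forall>m\<ge>M. dist (X m) L < r"
      by blast
  qed
  then show "convergent X"
    by (rule convergentI)
qed

text \<open>For a closed subspace \<open>E\<close>, the Hilbert tensor product of the scalar Hardy space with \<open>E\<close> is
  realised as the space \<open>hardy_on E\<close> of \<open>E\<close>-valued Hardy functions, the elementary tensor of \<open>f\<close>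
  and \<open>v\<close> being the function \<open>\<lambda>z. f z *\<^sub>C v\<close>. The tensor product of multiplication by \<open>\<phi>\<close>
  with an operator \<open>A\<close> on \<open>E\<close> is then \<open>hardy_mult (\<lambda>z v. \<phi> z *\<^sub>C A v)\<close>.\<close>

definition hardy_on :: "'a::chilbert_space set \<Rightarrow> 'a hardy set" where
  "hardy_on E = {f. \<forall>z. norm z < 1 \<longrightarrow> hardy_fun f z \<in> E}"

definition hardy_mult ::
  "(complex \<Rightarrow> 'a \<Rightarrow> 'a) \<Rightarrow> 'a::chilbert_space hardy \<Rightarrow> 'a hardy" where
  "hardy_mult \<Phi> f = Hardy (\<lambda>z. if norm z < 1 then \<Phi> z (hardy_fun f z) else 0)"

definition mult_tensor ::
  "(complex \<Rightarrow> complex) \<Rightarrow> ('a \<Rightarrow> 'a) \<Rightarrow> 'a::chilbert_space hardy \<Rightarrow> 'a hardy" where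
  "mult_tensor \<phi> A = hardy_mult (\<lambda>z v. \<phi> z *\<^sub>C A v)"

abbreviation id_tensor :: "('a \<Rightarrow> 'a) \<Rightarrow> 'a::chilbert_space hardy \<Rightarrow> 'a hardy" where
  "id_tensor \<equiv> mult_tensor (\<lambda>_. 1)"

abbreviation shift_tensor :: "('a \<Rightarrow> 'a) \<Rightarrow> 'a::chilbert_space hardy \<Rightarrow> 'a hardy" where
  "shift_tensor \<equiv> mult_tensor (\<lambda>z. z)"

section \<open>The characteristic function and the functional model\<close>

definition char_fun :: "('a::chilbert_space \<Rightarrow> 'a) \<Rightarrow> complex \<Rightarrow> 'a \<Rightarrow> 'a" where
  "char_fun S z x =
     - S x + z *\<^sub>C defect_op (adj S) (inv (\<lambda>y. y - z *\<^sub>C adj S y) (defect_op S x))"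

definition model_space :: "('a::chilbert_space \<Rightarrow> 'a) \<Rightarrow> 'a hardy set" where
  "model_space S =
     hardy_on (defect_space (adj S)) \<ominus> hardy_mult (char_fun S) ` hardy_on (defect_space S)"

definition compression :: "'a::complex_inner set \<Rightarrow> ('a \<Rightarrow> 'a) \<Rightarrow> 'a \<Rightarrow> 'a" where
  "compression K A f = orth_proj K (A f)"

end

theory Submission
  imports Defs
begin

text \<open>
  Write \<open>D\<^sub>*\<close> for the defect operator of \<open>T\<^sup>*\<close>. The unitary is
  \<open>h \<mapsto> \<Sum>n. z\<^sup>n D\<^sub>* T\<^sup>*\<^sup>n h\<close>, called \<open>obs\<close> below. Since
  \<open>\<parallel>D\<^sub>* y\<parallel>\<^sup>2 = \<parallel>y\<parallel>\<^sup>2 - \<parallel>T\<^sup>* y\<parallel>\<^sup>2\<close>, the squared norms of its coefficients telescope to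
  \<open>\<parallel>h\<parallel>\<^sup>2 - lim \<parallel>T\<^sup>*\<^sup>n h\<parallel>\<^sup>2\<close>, so purity makes it isometric. By construction it turns \<open>T\<^sup>*\<close> into
  the backward shift.

  Its range is the model space. The block operator \<open>[T\<^sup>*, D; D\<^sub>*, -T]\<close> built from \<open>T\<close> and the
  two defect operators is unitary, and the characteristic function is the transfer function of the linear
  system \<open>x\<^sub>n\<^sub>+\<^sub>1 = T\<^sup>* x\<^sub>n + D a\<^sub>n\<close>, \<open>b\<^sub>n = D\<^sub>* x\<^sub>n - T a\<^sub>n\<close> with \<open>x\<^sub>0 = 0\<close>:
  multiplication by it maps the function with coefficients \<open>a\<close> to the one with coefficients \<open>b\<close>
  (\<open>taylor_char_mult\<close>). Unitarity of the block operator preserves energy, which makes the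
  multiplication operator a contraction, and it also gives a formula for the adjoint of this operator
  (\<open>cinner_char_mult_sums\<close>). A function orthogonal to the range of the
  multiplication operator is one that this adjoint kills; running the system backwards from such a
  function produces an orbit of \<open>T\<^sup>*\<close> whose observations are exactly its coefficients
  (\<open>orthogonal_char_mult_imp_obs\<close>).

  Finally, the defining equations of the fundamental operators imply
  \<open>D\<^sub>* T\<^sub>1\<^sup>* = A\<^sub>1 D\<^sub>* + A\<^sub>2\<^sup>* D\<^sub>* T\<^sup>*\<close>, and the same with the indices exchanged
  (\<open>fundamental_operators_intertwine\<close>): both sides lie in the defect space and agree after
  application of \<open>D\<^sub>*\<close>, which is injective there. Read along an orbit of \<open>T\<^sup>*\<close>, this says that
  \<open>obs\<close> intertwines \<open>T\<^sub>1\<^sup>*\<close> with the adjoint of \<open>I \<otimes> A\<^sub>1\<^sup>* + M\<^sub>z \<otimes> A\<^sub>2\<close>; hence the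
  compression of the latter operator to the range of \<open>obs\<close> corresponds to \<open>T\<^sub>1\<close>
  (\<open>compression_pencil\<close>).

  Contractivity of \<open>T\<close> is the norm inequality for the polynomial \<open>x\<^sub>3\<close>, since the third coordinate
  is bounded by 1 on the tetrablock. Adjoints and defect operators are given by definite descriptions;
  behind their existence are the Riesz representation theorem (\<open>riesz_on\<close>) and the existence and
  uniqueness of positive square roots (\<open>sqrt_op_eq_root_lim\<close>).
\<close>

section \<open>Inner product and closed subspaces\<close>

lemma scaleC_minus1 [simp]: "(-1) *\<^sub>C x = - (x :: 'a::complex_vector)"
  using scaleC_of_real[of "-1" x] by simp

lemma scaleC_minus_right: "c *\<^sub>C (- x) = - (c *\<^sub>C x)" for x :: "'a::complex_vector"
  using scaleC_scaleC[of c "-1" x] scaleC_scaleC[of "-1" c x] by simp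

lemma scaleC_diff_right: "c *\<^sub>C (x - y) = c *\<^sub>C x - c *\<^sub>C y" for x :: "'a::complex_vector"
  using scaleC_add_right[of c x "- y"] by (simp add: scaleC_minus_right)

lemma scaleC_scaleR: "c *\<^sub>C r *\<^sub>R x = r *\<^sub>R c *\<^sub>C x" for x :: "'a::complex_vector"
  by (simp flip: scaleC_of_real add: scaleC_scaleC mult.commute)

lemma cinner_zero_left [simp]: "cinner 0 x = 0" for x :: "'a::complex_inner"
  using cinner_scaleC_left[of 0 0 x] by simp

lemma cinner_zero_right [simp]: "cinner x 0 = 0" for x :: "'a::complex_inner"
  using cinner_commute[of x 0] by simp

lemma cinner_minus_left: "cinner (- x) y = - cinner x y" for x :: "'a::complex_inner"
  using cinner_scaleC_left[of "-1" x y] by simp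

lemma cinner_diff_left: "cinner (x - y) z = cinner x z - cinner y z" for x :: "'a::complex_inner"
  using cinner_add_left[of x "- y" z] by (simp add: cinner_minus_left)

lemma cinner_add_right: "cinner x (y + z) = cinner x y + cinner x z" for x :: "'a::complex_inner"
  by (metis cinner_add_left cinner_commute complex_cnj_add)

lemma cinner_diff_right: "cinner x (y - z) = cinner x y - cinner x z" for x :: "'a::complex_inner"
  by (metis cinner_diff_left cinner_commute complex_cnj_diff)

lemma cinner_scaleC_right: "cinner x (c *\<^sub>C y) = cnj c * cinner x y" for x :: "'a::complex_inner"
  by (metis cinner_scaleC_left cinner_commute complex_cnj_mult)

lemma cinner_scaleR_left: "cinner (r *\<^sub>R x) y = of_real r * cinner x y" for x :: "'a::complex_inner"
  by (simp flip: scaleC_of_real add: cinner_scaleC_left)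

lemma cinner_scaleR_right: "cinner x (r *\<^sub>R y) = of_real r * cinner x y" for x :: "'a::complex_inner"
  by (simp flip: scaleC_of_real add: cinner_scaleC_right)

lemmas cinner_simps = cinner_add_left cinner_add_right cinner_diff_left cinner_diff_right
  cinner_scaleC_left cinner_scaleC_right cinner_scaleR_left cinner_scaleR_right

lemma cinner_self_eq_0 [simp]: "cinner x x = 0 \<longleftrightarrow> x = 0" for x :: "'a::complex_inner"
  by (simp add: cinner_self)

lemma cinner_eqI_right: "(\<And>z. cinner z x = cinner z y) \<Longrightarrow> x = y" for x :: "'a::complex_inner"
  by (metis cinner_diff_right cinner_self_eq_0 right_minus_eq)

lemma bounded_linear_cinner_left: "bounded_linear (\<lambda>x :: 'a::complex_inner. cinner x y)"
  by (rule bounded_linear_intro[where K = "norm y"])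
    (simp_all add: cinner_simps scaleR_conv_of_real norm_cinner_le)

lemma bounded_linear_cinner_right: "bounded_linear (\<lambda>y :: 'a::complex_inner. cinner x y)"
  by (rule bounded_linear_intro[where K = "norm x"])
    (simp_all add: cinner_simps scaleR_conv_of_real norm_cinner_le mult.commute[of _ "norm x"])

definition closed_csubspace :: "'a::complex_inner set \<Rightarrow> bool" where
  "closed_csubspace E \<longleftrightarrow>
     closed E \<and> 0 \<in> E \<and> (\<forall>x\<in>E. \<forall>y\<in>E. x + y \<in> E) \<and> (\<forall>c. \<forall>x\<in>E. c *\<^sub>C x \<in> E)"

lemma closed_csubspace_UNIV [simp]: "closed_csubspace UNIV"
  by (simp add: closed_csubspace_def)

lemma closed_csubspaceD:
  assumes "closed_csubspace E"
  shows "closed E" "0 \<in> E" "x \<in> E \<Longrightarrow> y \<in> E \<Longrightarrow> x + y \<in> E" "x \<in> E \<Longrightarrow> c *\<^sub>C x \<in> E"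
    "x \<in> E \<Longrightarrow> r *\<^sub>R x \<in> E" "x \<in> E \<Longrightarrow> - x \<in> E" "x \<in> E \<Longrightarrow> y \<in> E \<Longrightarrow> x - y \<in> E"
proof -
  show *: "closed E" "0 \<in> E" "\<And>x y. x \<in> E \<Longrightarrow> y \<in> E \<Longrightarrow> x + y \<in> E" "\<And>c x. x \<in> E \<Longrightarrow> c *\<^sub>C x \<in> E"
    using assms by (auto simp: closed_csubspace_def)
  show "x \<in> E \<Longrightarrow> r *\<^sub>R x \<in> E"
    using *(4)[of x "of_real r"] by (simp add: scaleC_of_real)
  show m: "\<And>x. x \<in> E \<Longrightarrow> - x \<in> E"
    using *(4)[of _ "-1"] by simp
  show "x \<in> E \<Longrightarrow> y \<in> E \<Longrightarrow> x - y \<in> E"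
    using *(3)[of x "- y"] m[of y] by simp
qed

lemma cinner_eqI_on:
  assumes "closed_csubspace E" "x \<in> E" "y \<in> E" "\<And>z. z \<in> E \<Longrightarrow> cinner z x = cinner z y"
  shows "x = y"
proof -
  have "cinner (x - y) (x - y) = 0"
    using assms(4)[OF closed_csubspaceD(7)[OF assms(1-3)]] by (simp add: cinner_diff_right)
  then show ?thesis
    by simp
qed

lemma linear_quadratic_nonneg:
  fixes b c :: real
  assumes "\<And>t. 0 \<le> 2 * t * b + t\<^sup>2 * c"
  shows "b = 0"
proof (rule ccontr)
  assume "b \<noteq> 0"
  \<comment> \<open>Near zero the linear term dominates; \<open>t = - b / d\<close> is small enough for any \<open>d > \<bar>c\<bar>\<close>.\<close>
  define d where "d = \<bar>c\<bar> + 1"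
  have d: "d > 0" "c \<le> d" by (auto simp: d_def)
  have "0 \<le> 2 * (- b / d) * b + (- b / d)\<^sup>2 * c" by (rule assms)
  also have "\<dots> \<le> 2 * (- b / d) * b + (- b / d)\<^sup>2 * d"
    using d by (intro add_left_mono mult_left_mono) auto
  also have "\<dots> = - (b\<^sup>2 / d)"
    using d by (simp add: power2_eq_square field_simps)
  finally show False
    using d \<open>b \<noteq> 0\<close> by (simp add: field_simps)
qed

text \<open>The representing vector is the minimiser over \<open>E\<close> of
  \<open>J x = \<parallel>x\<parallel>\<^sup>2 - 2 Re (f x)\<close>. In the parallelogram law the linear part of \<open>J\<close> cancels, so
  minimising sequences are Cauchy; the first-order condition at the minimiser is the claim. Applied with
  \<open>f x = \<langle>x, y\<rangle>\<close> this also yields the orthogonal projection of \<open>y\<close>.\<close>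

lemma riesz_on:
  fixes E :: "'a::chilbert_space set" and f :: "'a \<Rightarrow> complex"
  assumes E: "closed_csubspace E"
    and add: "\<And>x y. x \<in> E \<Longrightarrow> y \<in> E \<Longrightarrow> f (x + y) = f x + f y"
    and scale: "\<And>c x. x \<in> E \<Longrightarrow> f (c *\<^sub>C x) = c * f x"
    and bound: "\<And>x. x \<in> E \<Longrightarrow> norm (f x) \<le> K * norm x"
  shows "\<exists>w\<in>E. \<forall>x\<in>E. f x = cinner x w"
proof -
  note [intro] = closed_csubspaceD[OF E]
  define J where "J x = (norm x)\<^sup>2 - 2 * Re (f x)" for x
  have scaleR: "f (r *\<^sub>R x) = r * f x" if "x \<in> E" for r x
    using scale[OF that, of "of_real r"] by (simp add: scaleC_of_real)
  have diff: "f (x - y) = f x - f y" if "x \<in> E" "y \<in> E" for x y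
    using add[of x "- y"] scale[of y "-1"] that by auto
  have J_lower: "J x \<ge> - K\<^sup>2" if "x \<in> E" for x
  proof -
    have "Re (f x) \<le> K * norm x"
      using complex_Re_le_cmod bound[OF that] order_trans by blast
    moreover have "(norm x - K)\<^sup>2 \<ge> 0" by simp
    ultimately show ?thesis
      unfolding J_def power2_diff by (simp add: mult.commute)
  qed
  define m where "m = Inf (J ` E)"
  have bdd: "bdd_below (J ` E)"
    using J_lower by (auto intro!: bdd_belowI)
  have m_le: "m \<le> J x" if "x \<in> E" for x
    unfolding m_def using bdd that by (auto intro: cInf_lower)
  have "\<exists>x\<in>E. J x < m + 1 / Suc n" for n
  proof -
    have "Inf (J ` E) < m + 1 / Suc n" by (simp add: m_def)
    then show ?thesis
      using cInf_less_iff[OF _ bdd] closed_csubspaceD(2)[OF E] by blast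
  qed
  then obtain X where X: "\<And>n. X n \<in> E" "\<And>n. J (X n) < m + 1 / Suc n"
    by metis
  \<comment> \<open>The midpoint of two near-minimisers cannot lie below the infimum.\<close>
  have para: "(norm (x - y))\<^sup>2 \<le> 2 * (J x - m) + 2 * (J y - m)" if "x \<in> E" "y \<in> E" for x y
  proof -
    have "m \<le> J ((1/2) *\<^sub>R (x + y))"
      using that by (intro m_le) blast
    also have "\<dots> = (norm (x + y))\<^sup>2 / 4 - Re (f x) - Re (f y)"
      using that by (simp add: J_def scaleR add closed_csubspaceD(3)[OF E] power_divide
          add_divide_distrib)
    finally have "(norm (x + y))\<^sup>2 \<ge> 4 * m + 4 * Re (f x) + 4 * Re (f y)" by simp
    moreover have "(norm (x - y))\<^sup>2 + (norm (x + y))\<^sup>2 = 2 * (norm x)\<^sup>2 + 2 * (norm y)\<^sup>2"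
      by (simp add: power2_norm_eq_inner inner_diff_left inner_diff_right inner_add_left
          inner_add_right inner_commute)
    ultimately show ?thesis
      by (simp add: J_def)
  qed
  have "Cauchy X"
  proof (rule metric_CauchyI)
    fix e :: real
    assume e: "0 < e"
    then obtain M :: nat where "inverse (real (Suc M)) < e\<^sup>2 / 4"
      using reals_Archimedean[of "e\<^sup>2 / 4"] by auto
    then have M: "4 / real (Suc M) < e\<^sup>2"
      by (simp add: field_simps)
    have "dist (X i) (X j) < e" if "i \<ge> M" "j \<ge> M" for i j
    proof -
      have le: "J (X n) - m \<le> 1 / Suc M" if "n \<ge> M" for n
      proof -
        have "1 / Suc n \<le> 1 / real (Suc M)" using that by (simp add: frac_le)
        then show ?thesis using X(2)[of n] by linarith
      qed
      have "(norm (X i - X j))\<^sup>2 \<le> 4 / Suc M"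
        using para[OF X(1) X(1), of i j] le[OF that(1)] le[OF that(2)] by simp
      then have "(norm (X i - X j))\<^sup>2 < e\<^sup>2" using M by linarith
      then show ?thesis
        using e by (simp add: dist_norm power2_less_imp_less)
    qed
    then show "\<exists>M. \<forall>i\<ge>M. \<forall>j\<ge>M. dist (X i) (X j) < e" by blast
  qed
  then obtain w where w: "X \<longlonglongrightarrow> w"
    by (auto simp: Cauchy_convergent_iff convergent_def)
  have wE: "w \<in> E"
    using closed_csubspaceD(1)[OF E] X(1) w closed_sequentially by blast
  have "(\<lambda>n. f (X n - w)) \<longlonglongrightarrow> 0"
  proof (rule Lim_null_comparison)
    show "\<forall>\<^sub>F n in sequentially. norm (f (X n - w)) \<le> K * norm (X n - w)"
      using bound X(1) wE by (intro always_eventually) blast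
    show "(\<lambda>n. K * norm (X n - w)) \<longlonglongrightarrow> 0"
      using w by (auto intro!: tendsto_eq_intros)
  qed
  then have "(\<lambda>n. f (X n)) \<longlonglongrightarrow> f w"
    using diff[OF X(1) wE] by (simp add: LIM_zero_iff)
  then have "(\<lambda>n. J (X n)) \<longlonglongrightarrow> J w"
    unfolding J_def by (intro tendsto_intros w)
  moreover have "(\<lambda>n. m + 1 / Suc n) \<longlonglongrightarrow> m + 0"
    by (intro tendsto_intros LIMSEQ_Suc[OF lim_1_over_n])
  ultimately have Jw: "J w \<le> m"
    using X(2) by (auto intro: LIMSEQ_le less_imp_le)
  have Re_eq: "Re (f x) = Re (cinner x w)" if "x \<in> E" for x
  proof -
    have "inner w x - Re (f x) = 0"
    proof (rule linear_quadratic_nonneg)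
      fix t :: real
      have "J w \<le> J (w + t *\<^sub>R x)"
        using Jw m_le[of "w + t *\<^sub>R x"] that wE by (auto intro: order_trans)
      moreover have "(norm (w + t *\<^sub>R x))\<^sup>2 = (norm w)\<^sup>2 + 2 * t * inner w x + t\<^sup>2 * (norm x)\<^sup>2"
        by (simp add: power2_norm_eq_inner inner_add_left inner_add_right inner_commute)
          (simp add: power2_eq_square algebra_simps)
      ultimately show "0 \<le> 2 * t * (inner w x - Re (f x)) + t\<^sup>2 * (norm x)\<^sup>2"
        unfolding J_def using that wE
        by (simp add: add scaleR closed_csubspaceD[OF E] algebra_simps)
    qed
    then show ?thesis
      by (simp add: Re_cinner inner_commute)
  qed
  \<comment> \<open>The imaginary part follows from the real part at \<open>-\<i> x\<close>.\<close>
  have "f x = cinner x w" if "x \<in> E" for x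
  proof (rule complex_eqI)
    show "Re (f x) = Re (cinner x w)" using that by (rule Re_eq)
    have "Re (f ((- \<i>) *\<^sub>C x)) = Re (cinner ((- \<i>) *\<^sub>C x) w)"
      using that by (intro Re_eq) blast
    then show "Im (f x) = Im (cinner x w)"
      using that by (simp add: scale cinner_scaleC_left)
  qed
  then show ?thesis
    using wE by blast
qed

section \<open>Orthogonal projections and adjoints\<close>

lemma bounded_clinearI:
  assumes "\<And>x y. A (x + y) = A x + A y" "\<And>c x. A (c *\<^sub>C x) = c *\<^sub>C A x" "\<And>x. norm (A x) \<le> K * norm x"
  shows "bounded_clinear A"
  using assms unfolding bounded_clinear_on_def by blast

lemma bounded_clinear_imp_bounded_linear:
  assumes "bounded_clinear A"
  shows "bounded_linear A"
proof -
  obtain K where K: "\<And>x. norm (A x) \<le> K * norm x"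
    using assms unfolding bounded_clinear_on_def by auto
  have "A (r *\<^sub>R x) = r *\<^sub>R A x" for r x
    using assms unfolding bounded_clinear_on_def by (metis UNIV_I scaleC_of_real)
  then show ?thesis
    using assms K unfolding bounded_clinear_on_def
    by (intro bounded_linear_intro[where K = K]) (auto simp: mult.commute)
qed

lemma bounded_clinear_simps:
  assumes "bounded_clinear A"
  shows "A (x + y) = A x + A y" "A (x - y) = A x - A y" "A (c *\<^sub>C x) = c *\<^sub>C A x"
    "A (r *\<^sub>R x) = r *\<^sub>R A x" "A 0 = 0" "A (- x) = - A x"
proof -
  interpret bounded_linear A
    using assms by (rule bounded_clinear_imp_bounded_linear)
  show "A (x + y) = A x + A y" "A (x - y) = A x - A y" "A (c *\<^sub>C x) = c *\<^sub>C A x"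
    "A (r *\<^sub>R x) = r *\<^sub>R A x" "A 0 = 0" "A (- x) = - A x"
    using assms by (simp_all add: add diff scaleR zero neg bounded_clinear_on_def)
qed

lemma orth_proj_eqI:
  assumes "y \<in> S" "\<And>s. s \<in> S \<Longrightarrow> cinner (x - y) s = 0"
    "\<And>s t. s \<in> S \<Longrightarrow> t \<in> S \<Longrightarrow> s - t \<in> S"
  shows "orth_proj S x = y"
  unfolding orth_proj_def
proof (rule the_equality)
  fix y'
  assume y': "y' \<in> S \<and> (\<forall>s\<in>S. cinner (x - y') s = 0)"
  have "cinner (y' - y) (y' - y) = cinner (x - y) (y' - y) - cinner (x - y') (y' - y)"
    by (simp add: cinner_simps)
  then have "cinner (y' - y) (y' - y) = 0"
    using assms y' by simp
  then show "y' = y" by simp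
qed (use assms in blast)

context
  fixes E :: "'a::chilbert_space set"
  assumes E: "closed_csubspace E"
begin

lemma orth_proj_props: "orth_proj E x \<in> E \<and> (\<forall>s\<in>E. cinner (x - orth_proj E x) s = 0)"
proof -
  obtain w where w: "w \<in> E" "\<And>s. s \<in> E \<Longrightarrow> cinner s x = cinner s w"
    using riesz_on[OF E, of "\<lambda>s. cinner s x" "norm x"]
    by (auto simp: cinner_simps mult.commute norm_cinner_le)
  have *: "cinner (x - w) s = 0" if "s \<in> E" for s
    using w(2)[OF that] by (metis cinner_commute cinner_diff_left cancel_comm_monoid_add_class.diff_cancel)
  have "orth_proj E x = w"
    using w(1) * closed_csubspaceD(7)[OF E] by (rule orth_proj_eqI)
  then show ?thesis
    using w(1) * by simp
qed

lemma orth_proj_in: "orth_proj E x \<in> E"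
  using orth_proj_props by blast

lemma orth_proj_id: "x \<in> E \<Longrightarrow> orth_proj E x = x"
  by (rule orth_proj_eqI) (use closed_csubspaceD(7)[OF E] in auto)

lemma norm_orth_proj_le: "norm (orth_proj E x) \<le> norm x"
proof -
  have "inner (x - orth_proj E x) (orth_proj E x) = 0"
    using orth_proj_props[of x] by (metis Re_cinner zero_complex.sel(1))
  then have "(norm x)\<^sup>2 = (norm (orth_proj E x))\<^sup>2 + (norm (x - orth_proj E x))\<^sup>2"
    by (simp add: power2_norm_eq_inner inner_diff_left inner_diff_right inner_commute)
  then have "(norm (orth_proj E x))\<^sup>2 \<le> (norm x)\<^sup>2" by simp
  then show ?thesis
    by (simp add: power2_le_iff_abs_le)
qed

lemma bounded_clinear_orth_proj: "bounded_clinear (orth_proj E)"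
proof (rule bounded_clinearI[where K = 1])
  fix x y :: 'a and c
  show "orth_proj E (x + y) = orth_proj E x + orth_proj E y"
    by (rule orth_proj_eqI)
      (use orth_proj_props[of x] orth_proj_props[of y] closed_csubspaceD[OF E] in
        \<open>auto simp: cinner_simps\<close>)
  show "orth_proj E (c *\<^sub>C x) = c *\<^sub>C orth_proj E x"
    by (rule orth_proj_eqI)
      (use orth_proj_props[of x] closed_csubspaceD[OF E] in
        \<open>auto simp: cinner_simps simp flip: right_diff_distrib\<close>)
qed (simp add: norm_orth_proj_le)

lemma adj_on_eqI:
  assumes "w \<in> E" "\<And>x. x \<in> E \<Longrightarrow> cinner (A x) y = cinner x w"
  shows "adj_on E A y = w"
  unfolding adj_on_def
  by (rule the_equality) (use assms cinner_eqI_on[OF E] in auto)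

lemma adj_on_props:
  assumes A: "bounded_clinear_on E A"
  shows "adj_on E A y \<in> E" "x \<in> E \<Longrightarrow> cinner (A x) y = cinner x (adj_on E A y)"
proof -
  obtain K where K: "\<And>x. x \<in> E \<Longrightarrow> norm (A x) \<le> K * norm x"
    using A unfolding bounded_clinear_on_def by blast
  have "\<exists>w\<in>E. \<forall>x\<in>E. cinner (A x) y = cinner x w"
  proof (rule riesz_on[OF E, where K = "K * norm y"])
    fix x assume "x \<in> E"
    have "norm (cinner (A x) y) \<le> norm (A x) * norm y" by (rule norm_cinner_le)
    also have "\<dots> \<le> (K * norm x) * norm y"
      using K[OF \<open>x \<in> E\<close>] by (intro mult_right_mono) auto
    finally show "norm (cinner (A x) y) \<le> K * norm y * norm x" by (simp add: ac_simps)
  qed (use A in \<open>auto simp: bounded_clinear_on_def cinner_simps\<close>)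
  then obtain w where w: "w \<in> E" "\<And>x. x \<in> E \<Longrightarrow> cinner (A x) y = cinner x w"
    by blast
  have "adj_on E A y = w" using w by (rule adj_on_eqI)
  then show "adj_on E A y \<in> E" "x \<in> E \<Longrightarrow> cinner (A x) y = cinner x (adj_on E A y)"
    using w by simp_all
qed

lemma bounded_clinear_on_adj_on:
  assumes A: "bounded_clinear_on E A"
  shows "bounded_clinear_on E (adj_on E A)"
  unfolding bounded_clinear_on_def
proof (intro conjI ballI allI)
  note p = adj_on_props[OF A]
  show "adj_on E A x \<in> E" for x by (rule p)
  show "adj_on E A (x + y) = adj_on E A x + adj_on E A y" for x y
    by (rule adj_on_eqI) (simp_all add: p closed_csubspaceD[OF E] cinner_simps)
  show "adj_on E A (c *\<^sub>C x) = c *\<^sub>C adj_on E A x" for c x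
    by (rule adj_on_eqI) (simp_all add: p closed_csubspaceD[OF E] cinner_simps)
  obtain K where K: "\<And>x. x \<in> E \<Longrightarrow> norm (A x) \<le> K * norm x"
    using A unfolding bounded_clinear_on_def by blast
  have "norm (adj_on E A y) \<le> \<bar>K\<bar> * norm y" for y
  proof -
    let ?w = "adj_on E A y"
    have "(norm ?w)\<^sup>2 = norm (cinner ?w ?w)" by (simp add: cinner_self norm_power)
    also have "\<dots> = norm (cinner (A ?w) y)" by (simp add: p)
    also have "\<dots> \<le> norm (A ?w) * norm y" by (rule norm_cinner_le)
    also have "\<dots> \<le> (\<bar>K\<bar> * norm ?w) * norm y"
      using K[OF p(1)[of y]] by (intro mult_right_mono order_trans[OF K[OF p(1)]]) auto
    finally have "norm ?w * norm ?w \<le> norm ?w * (\<bar>K\<bar> * norm y)"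
      by (simp add: power2_eq_square ac_simps)
    then show ?thesis
      by (cases "norm ?w = 0") (simp_all add: mult_le_cancel_left)
  qed
  then show "\<exists>K. \<forall>x\<in>E. norm (adj_on E A x) \<le> K * norm x" by blast
qed

text \<open>Precomposition with the projection onto \<open>E\<close> turns \<open>A\<close> into a globally defined bounded
  operator with the same values on \<open>E\<close>.\<close>

lemma sums_bounded_clinear_on:
  assumes A: "bounded_clinear_on E A" and "\<And>n. u n \<in> E" "u sums x"
  shows "(\<lambda>n. A (u n)) sums A x"
proof -
  obtain K where K: "\<And>x. x \<in> E \<Longrightarrow> norm (A x) \<le> K * norm x"
    using A unfolding bounded_clinear_on_def by blast
  have "bounded_clinear (\<lambda>x. A (orth_proj E x))"
  proof (rule bounded_clinearI[where K = "\<bar>K\<bar>"])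
    fix x y :: 'a and c
    note P = bounded_clinear_orth_proj[unfolded bounded_clinear_on_def] orth_proj_in
    show "A (orth_proj E (x + y)) = A (orth_proj E x) + A (orth_proj E y)"
      "A (orth_proj E (c *\<^sub>C x)) = c *\<^sub>C A (orth_proj E x)"
      using A P unfolding bounded_clinear_on_def by simp_all
    have "norm (A (orth_proj E x)) \<le> \<bar>K\<bar> * norm (orth_proj E x)"
      using K[OF orth_proj_in, of x] abs_ge_self[of K]
      by (meson mult_right_mono norm_ge_zero order_trans)
    also have "\<dots> \<le> \<bar>K\<bar> * norm x"
      by (intro mult_left_mono norm_orth_proj_le) auto
    finally show "norm (A (orth_proj E x)) \<le> \<bar>K\<bar> * norm x" .
  qed
  from bounded_linear.sums[OF bounded_clinear_imp_bounded_linear[OF this] assms(3)]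
  have "(\<lambda>n. A (u n)) sums A (orth_proj E x)"
    using assms(2) by (simp add: orth_proj_id)
  moreover have "x \<in> E"
  proof (rule closed_sequentially[OF closed_csubspaceD(1)[OF E]])
    show "(\<Sum>i<n. u i) \<in> E" for n
      by (induction n) (use assms(2) closed_csubspaceD[OF E] in auto)
    show "(\<lambda>n. \<Sum>i<n. u i) \<longlonglongrightarrow> x"
      using assms(3) by (simp add: sums_def)
  qed
  ultimately show ?thesis
    by (simp add: orth_proj_id)
qed

end

lemma cinner_adj: "bounded_clinear A \<Longrightarrow> cinner (A x) y = cinner x (adj A y)"
  for A :: "'a::chilbert_space \<Rightarrow> 'a"
  using adj_on_props(2)[of UNIV A] by simp

lemma cinner_adj': "bounded_clinear A \<Longrightarrow> cinner (adj A x) y = cinner x (A y)"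
  for A :: "'a::chilbert_space \<Rightarrow> 'a"
  by (metis cinner_adj cinner_commute)

lemma bounded_clinear_adj: "bounded_clinear A \<Longrightarrow> bounded_clinear (adj A)"
  for A :: "'a::chilbert_space \<Rightarrow> 'a"
  by (rule bounded_clinear_on_adj_on) simp_all

lemma adj_adj: "bounded_clinear A \<Longrightarrow> adj (adj A) = A"
  for A :: "'a::chilbert_space \<Rightarrow> 'a"
  by (intro ext cinner_eqI_right) (metis cinner_adj bounded_clinear_adj cinner_adj')

lemma norm_adj_le:
  fixes A :: "'a::chilbert_space \<Rightarrow> 'a"
  assumes A: "bounded_clinear A" and le: "\<And>x. norm (A x) \<le> norm x"
  shows "norm (adj A x) \<le> norm x"
proof -
  let ?w = "adj A x"
  have "(norm ?w)\<^sup>2 = norm (cinner (A ?w) x)"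
    by (simp add: cinner_adj[OF A] cinner_self norm_power)
  also have "\<dots> \<le> norm (A ?w) * norm x"
    by (rule norm_cinner_le)
  also have "\<dots> \<le> norm ?w * norm x"
    by (intro mult_right_mono le) auto
  finally have "norm ?w * norm ?w \<le> norm ?w * norm x"
    by (simp add: power2_eq_square)
  then show ?thesis
    by (cases "norm ?w = 0") (simp_all add: mult_le_cancel_left)
qed

section \<open>Square roots of positive operators\<close>

lemma positive_op_selfadjoint:
  assumes "positive_op Q"
  shows "cinner (Q x) y = cinner x (Q y)"
proof -
  have Q: "Q (x + y) = Q x + Q y" "Q (c *\<^sub>C x) = c *\<^sub>C Q x" "Im (cinner (Q x) x) = 0" for x y c
    using assms unfolding positive_op_def by (simp_all add: bounded_clinear_simps)
  \<comment> \<open>Polarisation: the quadratic form is real at \<open>x + y\<close> and at \<open>x + \<i> y\<close>.\<close>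
  have 1: "Im (cinner (Q x) y) + Im (cinner (Q y) x) = 0"
    using Q(3)[of "x + y"] Q(3)[of x] Q(3)[of y] by (simp add: Q cinner_simps)
  have 2: "Re (cinner (Q y) x) - Re (cinner (Q x) y) = 0"
    using Q(3)[of "x + \<i> *\<^sub>C y"] Q(3)[of x] Q(3)[of y] by (simp add: Q cinner_simps)
  have "cinner (Q x) y = cnj (cinner (Q y) x)"
    using 1 2 by (auto simp: complex_eq_iff)
  then show ?thesis
    by (simp flip: cinner_commute)
qed

text \<open>Where a positive quadratic form vanishes its first variation vanishes too; the variation in the
  direction \<open>Q y\<close> is \<open>2 \<parallel>Q y\<parallel>\<^sup>2\<close>.\<close>

lemma positive_op_eq_0:
  assumes Q: "positive_op Q" and 0: "Re (cinner (Q y) y) = 0"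
  shows "Q y = 0"
proof -
  have lin: "Q (x + y) = Q x + Q y" "Q (r *\<^sub>R x) = r *\<^sub>R Q x" for x y r
    using Q unfolding positive_op_def by (simp_all add: bounded_clinear_simps)
  have "(norm (Q y))\<^sup>2 = 0"
  proof (rule linear_quadratic_nonneg)
    fix t :: real
    have "0 \<le> Re (cinner (Q (y + t *\<^sub>R Q y)) (y + t *\<^sub>R Q y))"
      using Q unfolding positive_op_def by blast
    then show "0 \<le> 2 * t * (norm (Q y))\<^sup>2 + t\<^sup>2 * Re (cinner (Q (Q y)) (Q y))"
      by (simp add: lin cinner_simps 0 positive_op_selfadjoint[OF Q, of "Q y" y] cinner_self
          power2_eq_square algebra_simps)
  qed
  then show ?thesis by simp
qed

text \<open>Commutativity factors \<open>Q\<^sup>2 - R\<^sup>2\<close> as \<open>(Q + R) (Q - R)\<close>. So the sum of the two positive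
  forms vanishes at \<open>y = Q x - R x\<close>, hence each does, and \<open>Q\<close> and \<open>R\<close> both kill \<open>y\<close>.\<close>

lemma positive_roots_commuting_unique:
  assumes Q: "positive_op Q" and R: "positive_op R" and eq: "\<And>x. Q (Q x) = R (R x)"
    and comm: "\<And>x. Q (R x) = R (Q x)"
  shows "Q = R"
proof
  fix x
  have lin: "Q (x - y) = Q x - Q y" "R (x - y) = R x - R y" for x y
    using Q R unfolding positive_op_def by (simp_all add: bounded_clinear_simps)
  define y where "y = Q x - R x"
  have "Q y + R y = 0"
    by (simp add: y_def lin eq comm)
  then have "cinner (Q y) y + cinner (R y) y = 0"
    by (simp flip: cinner_add_left)
  then have "Re (cinner (Q y) y) + Re (cinner (R y) y) = 0"
    by (metis plus_complex.sel(1) zero_complex.sel(1))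
  moreover have "Re (cinner (Q y) y) \<ge> 0" "Re (cinner (R y) y) \<ge> 0"
    using Q R unfolding positive_op_def by auto
  ultimately have "Q y = 0" "R y = 0"
    using positive_op_eq_0[OF Q] positive_op_eq_0[OF R] by auto
  then have "cinner y y = 0"
    using positive_op_selfadjoint[OF Q, of x y] positive_op_selfadjoint[OF R, of x y]
    by (subst y_def) (simp add: cinner_diff_left)
  then show "Q x = R x"
    by (simp add: y_def)
qed

text \<open>For a self-adjoint contraction \<open>X\<close>, the square root of \<open>I - X\<close> is obtained as \<open>I - Y\<close>, where
  \<open>Y\<close> is the limit of the iteration \<open>Y \<mapsto> (X + Y\<^sup>2) / 2\<close> from 0: the fixed point equation says
  \<open>(I - Y)\<^sup>2 = I - X\<close>. Convergence is by comparison with the same iteration for the number 1 in place of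
  \<open>X\<close>, which increases and is bounded by 1. The iterates are polynomials in \<open>X\<close>, so the limit is
  self-adjoint and inherits the intertwining relations of \<open>X\<close>.\<close>

primrec root_iter :: "('a::complex_inner \<Rightarrow> 'a) \<Rightarrow> nat \<Rightarrow> 'a \<Rightarrow> 'a" where
  "root_iter X 0 x = 0"
| "root_iter X (Suc n) x = (1/2) *\<^sub>R (X x + root_iter X n (root_iter X n x))"

primrec root_iter_real :: "nat \<Rightarrow> real" where
  "root_iter_real 0 = 0"
| "root_iter_real (Suc n) = (1 + (root_iter_real n)\<^sup>2) / 2"

lemma root_iter_real_bounds: "0 \<le> root_iter_real n" "root_iter_real n \<le> 1"
proof -
  have "0 \<le> root_iter_real n \<and> root_iter_real n \<le> 1"
    by (induction n) (auto simp: power_le_one)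
  then show "0 \<le> root_iter_real n" "root_iter_real n \<le> 1" by auto
qed

lemma root_iter_real_Suc_ge: "root_iter_real n \<le> root_iter_real (Suc n)"
  using zero_le_power2[of "root_iter_real n - 1"] by (simp add: power2_diff)

lemma Cauchy_root_iter_real: "Cauchy root_iter_real"
proof -
  have "incseq root_iter_real"
    by (rule incseq_SucI) (rule root_iter_real_Suc_ge)
  then obtain l where "root_iter_real \<longlonglongrightarrow> l"
    using incseq_convergent[of root_iter_real 1] root_iter_real_bounds(2) by metis
  then show ?thesis
    by (rule LIMSEQ_imp_Cauchy)
qed

context
  fixes X :: "'a::chilbert_space \<Rightarrow> 'a"
  assumes X: "bounded_clinear X"
begin

lemma root_iter_add: "root_iter X n (x + y) = root_iter X n x + root_iter X n y"
  using X by (induction n arbitrary: x y) (simp_all add: bounded_clinear_on_def algebra_simps)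

lemma root_iter_scaleC: "root_iter X n (c *\<^sub>C x) = c *\<^sub>C root_iter X n x"
  using X
  by (induction n arbitrary: x)
    (simp_all add: bounded_clinear_on_def scaleC_add_right scaleC_scaleR)

lemma root_iter_diff: "root_iter X n (x - y) = root_iter X n x - root_iter X n y"
  using root_iter_add[of n "x - y" y] by simp

lemma cinner_root_iter:
  assumes "\<And>x y. cinner (X x) y = cinner x (X y)"
  shows "cinner (root_iter X n x) y = cinner x (root_iter X n y)"
  by (induction n arbitrary: x y) (simp_all add: cinner_simps assms)

context
  assumes X_le: "\<And>x. norm (X x) \<le> norm x"
begin

lemma norm_root_iter_le: "norm (root_iter X n x) \<le> root_iter_real n * norm x"
proof (induction n arbitrary: x)
  case (Suc n)
  have "norm (root_iter X n (root_iter X n x)) \<le> root_iter_real n * (root_iter_real n * norm x)"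
    using Suc[of "root_iter X n x"] mult_left_mono[OF Suc[of x] root_iter_real_bounds(1)[of n]]
    by linarith
  then have "norm (X x + root_iter X n (root_iter X n x)) \<le> (1 + (root_iter_real n)\<^sup>2) * norm x"
    using norm_triangle_ineq[of "X x" "root_iter X n (root_iter X n x)"] X_le[of x]
    by (simp add: power2_eq_square algebra_simps)
  then show ?case
    by (simp del: scaleR_add_right)
qed simp

text \<open>With \<open>Y\<^sub>n\<close> the iterates for \<open>X\<close> and \<open>y\<^sub>n\<close> those for the number 1,
  \<open>Y\<^sup>2 - Z\<^sup>2 = Y (Y - Z) + (Y - Z) Z\<close> for consecutive iterates \<open>Y\<close> and \<open>Z\<close> is dominated by
  \<open>y (y - z) + (y - z) z = y\<^sup>2 - z\<^sup>2\<close>, so the bound passes from one increment to the next.\<close>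

lemma norm_root_iter_Suc_diff_le:
  "norm (root_iter X (Suc n) x - root_iter X n x) \<le> (root_iter_real (Suc n) - root_iter_real n) * norm x"
proof (induction n arbitrary: x)
  case 0
  show ?case using X_le[of x] by simp
next
  case (Suc n)
  let ?Y = "root_iter X (Suc n)" and ?Z = "root_iter X n"
  let ?y = "root_iter_real (Suc n)" and ?z = "root_iter_real n"
  have "root_iter X (Suc (Suc n)) x - ?Y x = (1/2) *\<^sub>R (?Y (?Y x) - ?Z (?Z x))"
    by (simp only: root_iter.simps(2)[of X "Suc n"] root_iter.simps(2)[of X n x] flip: scaleR_diff_right) simp
  also have "?Y (?Y x) - ?Z (?Z x) = ?Y (?Y x - ?Z x) + (?Y (?Z x) - ?Z (?Z x))"
    by (simp only: root_iter_diff) simp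
  finally have eq: "root_iter X (Suc (Suc n)) x - ?Y x
      = (1/2) *\<^sub>R (?Y (?Y x - ?Z x) + (?Y (?Z x) - ?Z (?Z x)))" .
  have "norm (?Y (?Y x - ?Z x)) \<le> ?y * ((?y - ?z) * norm x)"
    using norm_root_iter_le[of "Suc n" "?Y x - ?Z x"]
      mult_left_mono[OF Suc[of x] root_iter_real_bounds(1)[of "Suc n"]]
    by (rule order_trans)
  moreover have "norm (?Y (?Z x) - ?Z (?Z x)) \<le> (?y - ?z) * (?z * norm x)"
    using Suc[of "?Z x"] mult_left_mono[OF norm_root_iter_le[of n x], of "?y - ?z"]
      root_iter_real_Suc_ge[of n] by linarith
  ultimately have "norm (?Y (?Y x - ?Z x) + (?Y (?Z x) - ?Z (?Z x)))
      \<le> ?y * ((?y - ?z) * norm x) + (?y - ?z) * (?z * norm x)"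
    by (rule norm_triangle_mono)
  also have "\<dots> = 2 * ((root_iter_real (Suc (Suc n)) - ?y) * norm x)"
  proof -
    have "2 * (w - y) = (y + z) * (y - z)" if "w = (1 + y\<^sup>2) / 2" "y = (1 + z\<^sup>2) / 2" for w y z :: real
    proof -
      have "2 * w = 1 + y * y" "2 * y = 1 + z * z"
        unfolding that(1) unfolding that(2) by (simp_all add: power2_eq_square)
      then show ?thesis by (simp add: algebra_simps)
    qed
    from this[OF root_iter_real.simps(2) root_iter_real.simps(2)]
    have "2 * (root_iter_real (Suc (Suc n)) - ?y) * norm x = (?y + ?z) * (?y - ?z) * norm x"
      by (simp only:)
    then show ?thesis
      by (simp add: algebra_simps del: root_iter_real.simps)
  qed
  finally show ?case
    unfolding eq norm_scaleR by simp
qed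

lemma norm_root_iter_diff_le:
  "m \<le> n \<Longrightarrow> norm (root_iter X n x - root_iter X m x) \<le> (root_iter_real n - root_iter_real m) * norm x"
proof (induction n rule: dec_induct)
  case (step n)
  show ?case
    using norm_triangle_ineq[of "root_iter X (Suc n) x - root_iter X n x" "root_iter X n x - root_iter X m x"]
      norm_root_iter_Suc_diff_le[of n x] step.IH
    by (simp add: algebra_simps del: root_iter.simps root_iter_real.simps)
qed simp

lemma ex_LIMSEQ_root_iter: "\<exists>y. (\<lambda>n. root_iter X n x) \<longlonglongrightarrow> y"
proof -
  have "Cauchy (\<lambda>n. root_iter X n x)"
  proof (rule CauchyI')
    fix e :: real
    assume e: "0 < e"
    have nz: "norm x + 1 \<noteq> 0" using norm_ge_zero[of x] by linarith
    define d where "d = e / (norm x + 1)"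
    have d: "d > 0" using e by (simp add: d_def add_nonneg_pos)
    then obtain M where M: "\<And>m n. m \<ge> M \<Longrightarrow> n \<ge> M \<Longrightarrow> \<bar>root_iter_real n - root_iter_real m\<bar> < d"
      using CauchyD[OF Cauchy_root_iter_real, of d] by (auto simp: real_norm_def)
    have "norm (root_iter X m x - root_iter X n x) < e" if "m \<ge> M" "n > m" for m n
    proof -
      have "norm (root_iter X m x - root_iter X n x) \<le> (root_iter_real n - root_iter_real m) * norm x"
        using norm_root_iter_diff_le[of m n x] that by (simp add: norm_minus_commute)
      also have "\<dots> \<le> d * norm x"
        using M[of m n] that by (intro mult_right_mono) auto
      also have "\<dots> < d * (norm x + 1)" using d by simp
      finally show ?thesis
        using nz by (simp add: d_def)
    qed
    then show "\<exists>M. \<forall>m\<ge>M. \<forall>n>m. dist (root_iter X m x) (root_iter X n x) < e"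
      unfolding dist_norm by blast
  qed
  then show ?thesis
    by (simp add: Cauchy_convergent_iff convergent_def)
qed

end

end

definition root_lim :: "('a::chilbert_space \<Rightarrow> 'a) \<Rightarrow> 'a \<Rightarrow> 'a" where
  "root_lim X x = lim (\<lambda>n. root_iter X n x)"

context
  fixes X :: "'a::chilbert_space \<Rightarrow> 'a"
  assumes X: "bounded_clinear X" and X_le: "\<And>x. norm (X x) \<le> norm x"
begin

lemma LIMSEQ_root_lim: "(\<lambda>n. root_iter X n x) \<longlonglongrightarrow> root_lim X x"
  using ex_LIMSEQ_root_iter[OF X X_le, of x] unfolding root_lim_def
  by (metis limI)

lemma norm_root_lim_le: "norm (root_lim X x) \<le> norm x"
proof (rule LIMSEQ_le_const2[OF tendsto_norm[OF LIMSEQ_root_lim]])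
  have "norm (root_iter X n x) \<le> norm x" for n
    using norm_root_iter_le[OF X X_le, of n x] root_iter_real_bounds(2)[of n]
      mult_right_mono[of "root_iter_real n" 1 "norm x"] by simp
  then show "\<exists>N. \<forall>n\<ge>N. norm (root_iter X n x) \<le> norm x" by blast
qed

lemma bounded_clinear_root_lim: "bounded_clinear (root_lim X)"
proof (rule bounded_clinearI[where K = 1])
  fix x y :: 'a and c
  show "root_lim X (x + y) = root_lim X x + root_lim X y"
    using LIMSEQ_root_lim[of "x + y"] tendsto_add[OF LIMSEQ_root_lim[of x] LIMSEQ_root_lim[of y]]
    by (simp add: root_iter_add[OF X] LIMSEQ_unique)
  show "root_lim X (c *\<^sub>C x) = c *\<^sub>C root_lim X x"
    using LIMSEQ_root_lim[of "c *\<^sub>C x"]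
      bounded_linear.tendsto[OF bounded_linear_scaleC LIMSEQ_root_lim[of x]]
    by (simp add: root_iter_scaleC[OF X] LIMSEQ_unique)
qed (simp add: norm_root_lim_le)

lemma root_lim_fixpoint: "root_lim X x = (1/2) *\<^sub>R (X x + root_lim X (root_lim X x))"
proof -
  have "(\<lambda>n. root_iter X n (root_iter X n x - root_lim X x)) \<longlonglongrightarrow> 0"
  proof (rule Lim_null_comparison)
    have "norm (root_iter X n y) \<le> norm y" for n y
      using norm_root_iter_le[OF X X_le, of n y] root_iter_real_bounds(2)[of n]
        mult_right_mono[of "root_iter_real n" 1 "norm y"] by simp
    then show "\<forall>\<^sub>F n in sequentially. norm (root_iter X n (root_iter X n x - root_lim X x))
        \<le> norm (root_iter X n x - root_lim X x)"
      by simp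
    show "(\<lambda>n. norm (root_iter X n x - root_lim X x)) \<longlonglongrightarrow> 0"
      using LIMSEQ_root_lim[of x] by (auto intro!: tendsto_eq_intros)
  qed
  from tendsto_add[OF this LIMSEQ_root_lim[of "root_lim X x"]]
  have "(\<lambda>n. root_iter X n (root_iter X n x)) \<longlonglongrightarrow> root_lim X (root_lim X x)"
    by (simp add: root_iter_diff[OF X])
  then have "(\<lambda>n. root_iter X (Suc n) x) \<longlonglongrightarrow> (1/2) *\<^sub>R (X x + root_lim X (root_lim X x))"
    by (auto intro!: tendsto_intros)
  then show ?thesis
    using LIMSEQ_Suc[OF LIMSEQ_root_lim[of x]] LIMSEQ_unique by blast
qed

end

text \<open>Besides the relation between the two defect operators of a contraction, this gives uniqueness of the
  square root: any square root of \<open>I - X\<close> commutes with \<open>X\<close>, hence with the limit.\<close>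

lemma root_lim_intertwines:
  fixes X X' B :: "'a::chilbert_space \<Rightarrow> 'a"
  assumes X: "bounded_clinear X" "\<And>x. norm (X x) \<le> norm x"
    and X': "bounded_clinear X'" "\<And>x. norm (X' x) \<le> norm x"
    and B: "bounded_clinear B" and eq: "\<And>x. B (X x) = X' (B x)"
  shows "B (root_lim X x) = root_lim X' (B x)"
proof -
  have "B (root_iter X n x) = root_iter X' n (B x)" for n x
    by (induction n arbitrary: x) (simp_all add: bounded_clinear_simps[OF B] eq)
  then have "(\<lambda>n. root_iter X' n (B x)) \<longlonglongrightarrow> B (root_lim X x)"
    using bounded_linear.tendsto[OF bounded_clinear_imp_bounded_linear[OF B] LIMSEQ_root_lim[OF X]]
    by simp
  then show ?thesis
    using LIMSEQ_root_lim[OF X'] LIMSEQ_unique by blast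
qed

lemma sqrt_op_eq_root_lim:
  fixes X :: "'a::chilbert_space \<Rightarrow> 'a"
  assumes X: "bounded_clinear X" "\<And>x. norm (X x) \<le> norm x"
    and sa: "\<And>x y. cinner (X x) y = cinner x (X y)"
  shows "positive_op (\<lambda>x. x - root_lim X x)" (is "positive_op ?R")
    and "(\<lambda>x. x - root_lim X x) \<circ> (\<lambda>x. x - root_lim X x) = (\<lambda>x. x - X x)"
    and "sqrt_op (\<lambda>x. x - X x) = (\<lambda>x. x - root_lim X x)"
proof -
  note lin = bounded_clinear_simps[OF bounded_clinear_root_lim[OF X]]
  have blin: "bounded_clinear ?R"
  proof (rule bounded_clinearI[where K = 2])
    show "norm (x - root_lim X x) \<le> 2 * norm x" for x
      using norm_triangle_ineq4[of x "root_lim X x"] norm_root_lim_le[OF X, of x] by simp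
  qed (simp_all add: lin scaleC_diff_right)
  have sa_lim: "cinner (root_lim X x) y = cinner x (root_lim X y)" for x y
    using bounded_linear.tendsto[OF bounded_linear_cinner_left LIMSEQ_root_lim[OF X, of x], of y]
      bounded_linear.tendsto[OF bounded_linear_cinner_right LIMSEQ_root_lim[OF X, of y], of x]
      LIMSEQ_unique
    by (force simp: cinner_root_iter[OF X(1) sa])
  have "cnj (cinner (root_lim X x) x) = cinner (root_lim X x) x" for x
    using sa_lim[of x x] by (metis cinner_commute)
  from arg_cong[OF this, of Im] have im: "Im (cinner (root_lim X x) x) = 0" for x
    by simp
  have re: "Re (cinner (root_lim X x) x) \<le> (norm x)\<^sup>2" for x
  proof -
    have "Re (cinner (root_lim X x) x) \<le> norm (root_lim X x) * norm x"
      using complex_Re_le_cmod norm_cinner_le order_trans by blast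
    also have "\<dots> \<le> norm x * norm x"
      by (intro mult_right_mono norm_root_lim_le[OF X]) auto
    finally show ?thesis by (simp add: power2_eq_square)
  qed
  show pos: "positive_op ?R"
    unfolding positive_op_def using blin im re by (simp add: cinner_diff_left cinner_self)
  have sq: "?R (?R x) = x - X x" for x
  proof -
    have "root_lim X x + root_lim X x = X x + root_lim X (root_lim X x)"
      using root_lim_fixpoint[OF X, of x]
      by (metis scaleR_half_double scaleR_right_distrib)
    then show ?thesis
      by (simp add: lin algebra_simps)
  qed
  then show sq': "?R \<circ> ?R = (\<lambda>x. x - X x)" by auto
  show "sqrt_op (\<lambda>x. x - X x) = ?R"
    unfolding sqrt_op_def
  proof (rule the_equality)
    fix Q
    assume Q: "positive_op Q \<and> Q \<circ> Q = (\<lambda>x. x - X x)"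
    then have QQ: "Q (Q x) = x - X x" for x by (metis comp_apply)
    have Qb: "bounded_clinear Q" using Q unfolding positive_op_def by blast
    \<comment> \<open>Any other root \<open>Q\<close> commutes with \<open>X = I - Q\<^sup>2\<close>.\<close>
    have XQ: "X x = x - Q (Q x)" for x by (simp add: QQ)
    have "Q (X x) = X (Q x)" for x
      by (simp add: XQ bounded_clinear_simps[OF Qb])
    then have "Q (root_lim X x) = root_lim X (Q x)" for x
      by (intro root_lim_intertwines[OF X X Qb])
    then show "Q = ?R"
      using Q pos sq QQ
      by (intro positive_roots_commuting_unique) (auto simp: bounded_clinear_simps[OF Qb])
  qed (use pos sq' in blast)
qed

section \<open>Defect operators\<close>

locale contraction_op =
  fixes T :: "'a::chilbert_space \<Rightarrow> 'a"
  assumes T: "bounded_clinear T" and T_le: "norm (T x) \<le> norm x"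
begin

abbreviation "Ta \<equiv> adj T"
abbreviation "D \<equiv> defect_op T"
abbreviation "Da \<equiv> defect_op (adj T)"

lemma Ta: "bounded_clinear Ta"
  using T by (rule bounded_clinear_adj)

lemma Ta_le: "norm (Ta x) \<le> norm x"
  using T T_le by (rule norm_adj_le)

lemma TaT: "bounded_clinear (\<lambda>x. Ta (T x))" "norm (Ta (T x)) \<le> norm x"
  "cinner (Ta (T x)) y = cinner x (Ta (T y))"
proof -
  show le: "norm (Ta (T x)) \<le> norm x" for x
    using Ta_le[of "T x"] T_le[of x] by simp
  show "bounded_clinear (\<lambda>x. Ta (T x))"
    by (rule bounded_clinearI[where K = 1])
      (simp_all add: bounded_clinear_simps[OF T] bounded_clinear_simps[OF Ta] le)
  show "cinner (Ta (T x)) y = cinner x (Ta (T y))"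
    by (simp add: cinner_adj[OF T, symmetric] cinner_adj'[OF T])
qed

lemma defect_op_eq: "D = (\<lambda>x. x - root_lim (\<lambda>x. Ta (T x)) x)"
  unfolding defect_op_def by (rule sqrt_op_eq_root_lim(3)[OF TaT])

lemma positive_defect_op: "positive_op D"
  unfolding defect_op_eq by (rule sqrt_op_eq_root_lim(1)[OF TaT])

lemma bounded_clinear_defect_op: "bounded_clinear D"
  using positive_defect_op unfolding positive_op_def by blast

lemma defect_op_selfadjoint: "cinner (D x) y = cinner x (D y)"
  by (rule positive_op_selfadjoint[OF positive_defect_op])

lemma defect_op_square: "D (D x) = x - Ta (T x)"
  using fun_cong[OF sqrt_op_eq_root_lim(2)[OF TaT], of x]
  unfolding defect_op_eq comp_def .

lemma closed_csubspace_defect_space: "closed_csubspace (defect_space T)"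
  unfolding closed_csubspace_def defect_space_def
proof (intro conjI ballI allI)
  note lin = bounded_clinear_simps[OF bounded_clinear_defect_op]
  show "closed (closure (range D))" by simp
  have "D 0 \<in> closure (range D)" by (rule closure_subset[THEN subsetD, OF rangeI])
  then show "0 \<in> closure (range D)" by (simp add: lin)
  fix x y assume xy: "x \<in> closure (range D)" "y \<in> closure (range D)"
  obtain u v where u: "\<And>n. u n \<in> range D" "u \<longlonglongrightarrow> x" and v: "\<And>n. v n \<in> range D" "v \<longlonglongrightarrow> y"
    using xy unfolding closure_sequential by blast
  have "u n + v n \<in> range D" for n
  proof -
    obtain a b where "u n = D a" "v n = D b" using u(1)[of n] v(1)[of n] by auto
    then have "u n + v n = D (a + b)" by (simp add: lin)
    then show ?thesis by simp
  qed
  then show "x + y \<in> closure (range D)"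
    unfolding closure_sequential using tendsto_add[OF u(2) v(2)]
    by (intro exI[of _ "\<lambda>n. u n + v n"]) simp
next
  fix c x assume "x \<in> closure (range D)"
  then obtain u where u: "\<And>n. u n \<in> range D" "u \<longlonglongrightarrow> x"
    unfolding closure_sequential by blast
  have "c *\<^sub>C u n \<in> range D" for n
  proof -
    obtain a where "u n = D a" using u(1)[of n] by auto
    then have "c *\<^sub>C u n = D (c *\<^sub>C a)"
      by (simp add: bounded_clinear_simps[OF bounded_clinear_defect_op])
    then show ?thesis by simp
  qed
  then show "c *\<^sub>C x \<in> closure (range D)"
    unfolding closure_sequential
    using bounded_linear.tendsto[OF bounded_linear_scaleC u(2), of c]
    by (intro exI[of _ "\<lambda>n. c *\<^sub>C u n"]) simp
qed

lemma defect_op_in: "D x \<in> defect_space T"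
  unfolding defect_space_def by (rule closure_subset[THEN subsetD, OF rangeI])

text \<open>A vector killed by the self-adjoint operator \<open>D\<close> is orthogonal to its range, hence to the closure of
  the range.\<close>

lemma defect_op_inj_on:
  assumes x: "x \<in> defect_space T" and "D x = 0"
  shows "x = 0"
proof -
  obtain u where u: "\<And>n. u n \<in> range D" "u \<longlonglongrightarrow> x"
    using x unfolding defect_space_def closure_sequential by blast
  have "cinner (u n) x = 0" for n
    using u(1)[of n] assms(2) by (auto simp: defect_op_selfadjoint)
  then have "(\<lambda>n. 0) \<longlonglongrightarrow> cinner x x"
    using bounded_linear.tendsto[OF bounded_linear_cinner_left u(2), of x] by simp
  then show ?thesis
    by (simp add: LIMSEQ_const_iff)
qed

lemma contraction_op_adj: "contraction_op Ta"
  by unfold_locales (rule Ta Ta_le)+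

sublocale adj: contraction_op Ta
  rewrites "adj (adj T) = T"
  by (rule contraction_op_adj) (rule adj_adj[OF T])

lemma defect_intertwines: "T (D x) = Da (T x)"
proof -
  have "T (root_lim (\<lambda>x. Ta (T x)) x) = root_lim (\<lambda>x. T (Ta x)) (T x)"
    by (rule root_lim_intertwines[OF TaT(1,2) adj.TaT(1,2) T]) simp
  then show ?thesis
    unfolding defect_op_eq adj.defect_op_eq by (simp add: bounded_clinear_simps[OF T])
qed

lemma adj_defect_intertwines: "Ta (Da x) = D (Ta x)"
  using contraction_op.defect_intertwines[OF contraction_op_adj] by (simp add: adj_adj[OF T])

lemma adj_maps_defect_space:
  assumes "x \<in> defect_space Ta"
  shows "Ta x \<in> defect_space T"
proof -
  obtain u where u: "\<And>n. u n \<in> range Da" "u \<longlonglongrightarrow> x"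
    using assms unfolding defect_space_def closure_sequential by blast
  have "Ta (u n) \<in> defect_space T" for n
    using u(1)[of n] adj_defect_intertwines defect_op_in by auto
  moreover have "(\<lambda>n. Ta (u n)) \<longlonglongrightarrow> Ta x"
    using bounded_linear.tendsto[OF bounded_clinear_imp_bounded_linear[OF Ta] u(2)] .
  ultimately show ?thesis
    by (rule closed_sequentially[OF closed_csubspaceD(1)[OF closed_csubspace_defect_space]])
qed

text \<open>These three lemmas say that \<open>U = [T\<^sup>*, D; D\<^sub>*, -T]\<close> is unitary: the right-hand side below displays
  its adjoint \<open>[T, D\<^sub>*; D, -T\<^sup>*]\<close>, and the next two give \<open>U U\<^sup>* = I\<close> and that \<open>U\<close> is
  isometric. The last two rest on \<open>T D = D\<^sub>* T\<close>.\<close>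

lemma colligation_adjoint:
  "cinner (Ta x + D a) u + cinner (Da x - T a) g = cinner x (T u + Da g) + cinner a (D u - Ta g)"
  by (simp add: cinner_simps cinner_adj[OF T] cinner_adj'[OF T] defect_op_selfadjoint
      adj.defect_op_selfadjoint)

lemma colligation_coisometric:
  "Ta (T u + Da g) + D (D u - Ta g) = u"
  "Da (T u + Da g) - T (D u - Ta g) = g"
  using adj_defect_intertwines[of g] defect_intertwines[of u] adj.defect_op_square[of g]
  by (simp_all add: bounded_clinear_simps[OF T] bounded_clinear_simps[OF Ta]
      bounded_clinear_simps[OF bounded_clinear_defect_op]
      bounded_clinear_simps[OF adj.bounded_clinear_defect_op] defect_op_square)

lemma colligation_isometric:
  "(norm (Ta x + D a))\<^sup>2 + (norm (Da x - T a))\<^sup>2 = (norm x)\<^sup>2 + (norm a)\<^sup>2"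
proof -
  have "T (Ta x + D a) + Da (Da x - T a) = x" "D (Ta x + D a) - Ta (Da x - T a) = a"
    using adj_defect_intertwines[of x] defect_intertwines[of a] adj.defect_op_square[of x]
    by (simp_all add: bounded_clinear_simps[OF T] bounded_clinear_simps[OF Ta]
        bounded_clinear_simps[OF bounded_clinear_defect_op]
        bounded_clinear_simps[OF adj.bounded_clinear_defect_op] defect_op_square)
  then have "cinner (Ta x + D a) (Ta x + D a) + cinner (Da x - T a) (Da x - T a)
      = cinner x x + cinner a a"
    using colligation_adjoint[of x a "Ta x + D a" "Da x - T a"] by simp
  then show ?thesis
    unfolding cinner_self by (simp only: of_real_add[symmetric] of_real_eq_iff)
qed

end

section \<open>Multiplication operators on the Hardy space\<close>

lemma cinner_hardy_sums:
  "(\<lambda>n. cinner (taylor f n) (taylor g n)) sums cinner f g" for f g :: "'a::chilbert_space hardy"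
  unfolding cinner_hardy_def by (rule summable_sums) (rule summable_cinner_taylor)

lemma sum_norm_taylor_le: "(\<Sum>n<N. (norm (taylor f n))\<^sup>2) \<le> (norm f)\<^sup>2"
  for f :: "'a::chilbert_space hardy"
  using sum_le_suminf[of "\<lambda>n. (norm (taylor f n))\<^sup>2" "{..<N}"] norm_hardy_sums[of f]
  by (simp add: sums_iff)

lemma hardy_fun_sums:
  "norm z < 1 \<Longrightarrow> (\<lambda>n. z ^ n *\<^sub>C taylor f n) sums hardy_fun f z"
  using disc_series_taylor[of f] unfolding disc_series_def by blast

lemma taylor_hardy_mult_eqI:
  assumes "square_summable b"
    and "\<And>z. norm z < 1 \<Longrightarrow> (\<lambda>n. z ^ n *\<^sub>C b n) sums \<Phi> z (hardy_fun f z)"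
  shows "taylor (hardy_mult \<Phi> f) = b"
proof -
  have "disc_series b (\<lambda>z. if norm z < 1 then \<Phi> z (hardy_fun f z) else 0)"
    using assms(2) unfolding disc_series_def by simp
  then show ?thesis
    using assms(1) unfolding hardy_mult_def
    by (intro taylor_eqI) (subst Hardy_inverse, auto)
qed

text \<open>For the direction from values to coefficients, projecting the coefficients onto \<open>E\<close> gives a second
  expansion of the same function, and expansions are unique.\<close>

lemma hardy_on_iff_taylor:
  assumes E: "closed_csubspace E"
  shows "f \<in> hardy_on E \<longleftrightarrow> (\<forall>n. taylor f n \<in> E)"
proof
  assume f: "\<forall>n. taylor f n \<in> E"
  have "hardy_fun f z \<in> E" if "norm z < 1" for z
  proof (rule closed_sequentially[OF closed_csubspaceD(1)[OF E]])
    show "(\<Sum>i<n. z ^ i *\<^sub>C taylor f i) \<in> E" for n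
      by (induction n) (use f closed_csubspaceD[OF E] in auto)
    show "(\<lambda>n. \<Sum>i<n. z ^ i *\<^sub>C taylor f i) \<longlonglongrightarrow> hardy_fun f z"
      using hardy_fun_sums[OF that] by (simp add: sums_def)
  qed
  then show "f \<in> hardy_on E"
    by (simp add: hardy_on_def)
next
  assume f: "f \<in> hardy_on E"
  note P = bounded_clinear_orth_proj[OF E]
  have "disc_series (\<lambda>n. orth_proj E (taylor f n)) (hardy_fun f)"
    unfolding disc_series_def
  proof (intro conjI allI impI)
    fix z :: complex
    assume z: "norm z < 1"
    have "hardy_fun f z \<in> E" using f z by (simp add: hardy_on_def)
    then show "(\<lambda>n. z ^ n *\<^sub>C orth_proj E (taylor f n)) sums hardy_fun f z"
      using bounded_linear.sums[OF bounded_clinear_imp_bounded_linear[OF P] hardy_fun_sums[OF z, of f]]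
      by (simp add: bounded_clinear_simps[OF P] orth_proj_id[OF E])
  qed (use disc_series_taylor[of f] in \<open>simp add: disc_series_def\<close>)
  then have "taylor f n = orth_proj E (taylor f n)" for n
    using taylor_eqI by metis
  then show "\<forall>n. taylor f n \<in> E"
    using orth_proj_in[OF E] by metis
qed

context
  fixes E :: "'a::chilbert_space set" and A f
  assumes E: "closed_csubspace E" and A: "bounded_clinear_on E A" and f: "f \<in> hardy_on E"
begin

lemma square_summable_image: "square_summable (\<lambda>n. A (taylor f n))"
proof -
  obtain K where K: "\<And>x. x \<in> E \<Longrightarrow> norm (A x) \<le> K * norm x"
    using A unfolding bounded_clinear_on_def by blast
  show ?thesis
    unfolding square_summable_def
  proof (rule summable_comparison_test'[where N = 0])
    show "summable (\<lambda>n. K\<^sup>2 * (norm (taylor f n))\<^sup>2)"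
      using square_summable_taylor[of f] unfolding square_summable_def by (rule summable_mult)
    fix n
    have "norm (A (taylor f n)) \<le> K * norm (taylor f n)"
      using f K by (simp add: hardy_on_iff_taylor[OF E])
    then show "norm ((norm (A (taylor f n)))\<^sup>2) \<le> K\<^sup>2 * (norm (taylor f n))\<^sup>2"
      by (simp flip: power_mult_distrib add: power_mono)
  qed
qed

lemma image_series_sums:
  assumes "norm z < 1"
  shows "(\<lambda>n. z ^ n *\<^sub>C A (taylor f n)) sums A (hardy_fun f z)"
proof -
  have fE: "taylor f n \<in> E" for n
    using f by (simp add: hardy_on_iff_taylor[OF E])
  have "(\<lambda>n. A (z ^ n *\<^sub>C taylor f n)) sums A (hardy_fun f z)"
    by (intro sums_bounded_clinear_on[OF E A] hardy_fun_sums assms closed_csubspaceD(4)[OF E] fE)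
  then show ?thesis
    using A fE by (simp add: bounded_clinear_on_def)
qed

lemma taylor_id_tensor: "taylor (id_tensor A f) = (\<lambda>n. A (taylor f n))"
  unfolding mult_tensor_def
  by (rule taylor_hardy_mult_eqI) (simp_all add: square_summable_image image_series_sums)

lemma taylor_shift_tensor:
  "taylor (shift_tensor A f) = (\<lambda>n. case n of 0 \<Rightarrow> 0 | Suc k \<Rightarrow> A (taylor f k))"
  unfolding mult_tensor_def
proof (rule taylor_hardy_mult_eqI)
  show "square_summable (\<lambda>n. case n of 0 \<Rightarrow> 0 | Suc k \<Rightarrow> A (taylor f k))"
    using square_summable_image unfolding square_summable_def
    by (subst summable_Suc_iff[symmetric]) simp
  fix z :: complex
  assume "norm z < 1"
  from bounded_linear.sums[OF bounded_linear_scaleC image_series_sums[OF this], of z]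
  have "(\<lambda>n. z ^ Suc n *\<^sub>C A (taylor f n)) sums (z *\<^sub>C A (hardy_fun f z))"
    by (simp add: scaleC_scaleC)
  then show "(\<lambda>n. z ^ n *\<^sub>C (case n of 0 \<Rightarrow> 0 | Suc k \<Rightarrow> A (taylor f k))) sums (z *\<^sub>C A (hardy_fun f z))"
    using sums_Suc_iff[of "\<lambda>n. z ^ n *\<^sub>C (case n of 0 \<Rightarrow> 0 | Suc k \<Rightarrow> A (taylor f k))"] by simp
qed

end

section \<open>The characteristic function as the transfer function of a unitary system\<close>

context contraction_op
begin

text \<open>The state of the system with input \<open>a\<close>, started at rest. Its output is \<open>D\<^sub>* x\<^sub>n - T a\<^sub>n\<close>.\<close>

primrec state :: "(nat \<Rightarrow> 'a) \<Rightarrow> nat \<Rightarrow> 'a" where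
  "state a 0 = 0"
| "state a (Suc n) = Ta (state a n) + D (a n)"

lemma energy_balance:
  "(\<Sum>n<N. (norm (Da (state a n) - T (a n)))\<^sup>2) + (norm (state a N))\<^sup>2 = (\<Sum>n<N. (norm (a n))\<^sup>2)"
proof (induction N)
  case (Suc N)
  then show ?case
    using colligation_isometric[of "state a N" "a N"] by simp
qed simp

lemma norm_state_le: "norm (state (taylor f) n) \<le> norm f"
proof -
  have "0 \<le> (\<Sum>k<n. (norm (Da (state (taylor f) k) - T (taylor f k)))\<^sup>2)"
    by (simp add: sum_nonneg)
  then have "(norm (state (taylor f) n))\<^sup>2 \<le> (norm f)\<^sup>2"
    using energy_balance[of "taylor f" n] sum_norm_taylor_le[of f n] by linarith
  then show ?thesis
    by (simp add: power2_le_iff_abs_le)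
qed

lemma resolvent_eq:
  assumes z: "norm z < 1" and "y - z *\<^sub>C Ta y = w"
  shows "inv (\<lambda>y. y - z *\<^sub>C Ta y) w = y"
proof -
  have "inj (\<lambda>y. y - z *\<^sub>C Ta y)"
  proof (rule injI)
    fix x y
    assume "x - z *\<^sub>C Ta x = y - z *\<^sub>C Ta y"
    then have "x - y = z *\<^sub>C Ta (x - y)"
      by (simp add: bounded_clinear_simps[OF Ta] scaleC_diff_right algebra_simps)
    then have "norm (x - y) = norm z * norm (Ta (x - y))"
      by (metis norm_scaleC)
    also have "\<dots> \<le> norm z * norm (x - y)"
      by (intro mult_left_mono Ta_le) auto
    finally have "(1 - norm z) * norm (x - y) \<le> 0"
      by (simp add: algebra_simps)
    then show "x = y"
      using z by (simp add: mult_le_0_iff)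
  qed
  then show ?thesis
    using inv_f_f[of "\<lambda>y. y - z *\<^sub>C Ta y" y] assms(2) by simp
qed

text \<open>The generating function \<open>X\<close> of the states solves \<open>X = z (T\<^sup>* X + D f)\<close>, because the state
  starts at 0. So \<open>X = z (I - z T\<^sup>*)\<^sup>-\<^sup>1 D f\<close>, and the generating function \<open>D\<^sub>* X - T f\<close> of the outputs
  is the characteristic function applied to \<open>f\<close>. The energy balance bounds the states, so that \<open>X\<close>
  converges in the disc, and makes the outputs square summable.\<close>

lemma taylor_char_mult:
  "taylor (hardy_mult (char_fun T) f) = (\<lambda>n. Da (state (taylor f) n) - T (taylor f n))"
proof (rule taylor_hardy_mult_eqI)
  let ?a = "taylor f" and ?x = "state (taylor f)"
  let ?b = "\<lambda>n. Da (?x n) - T (?a n)"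
  show "square_summable ?b"
    unfolding square_summable_def
  proof (rule summableI_nonneg_bounded[where x = "(norm f)\<^sup>2"])
    show "(\<Sum>n<N. (norm (?b n))\<^sup>2) \<le> (norm f)\<^sup>2" for N
      using energy_balance[of ?a N] sum_norm_taylor_le[of f N] zero_le_power2[of "norm (?x N)"]
      by linarith
  qed simp
  fix z :: complex
  assume z: "norm z < 1"
  note lin = bounded_clinear_simps[OF T] bounded_clinear_simps[OF Ta]
    bounded_clinear_simps[OF bounded_clinear_defect_op]
    bounded_clinear_simps[OF adj.bounded_clinear_defect_op]
  note sums_op = bounded_linear.sums[OF bounded_clinear_imp_bounded_linear]
  have "summable (\<lambda>n. z ^ n *\<^sub>C ?x n)"
  proof (rule summable_comparison_test'[where N = 0])
    show "summable (\<lambda>n. norm f * norm z ^ n)"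
      using z by (intro summable_mult summable_geometric) simp
    show "norm (z ^ n *\<^sub>C ?x n) \<le> norm f * norm z ^ n" for n
      using mult_left_mono[OF norm_state_le[of f n], of "norm z ^ n"]
      by (simp add: norm_scaleC norm_power mult.commute)
  qed
  then obtain X where X: "(\<lambda>n. z ^ n *\<^sub>C ?x n) sums X"
    by (auto simp: summable_def)
  define Y where "Y = Ta X + D (hardy_fun f z)"
  have "(\<lambda>n. z *\<^sub>C (Ta (z ^ n *\<^sub>C ?x n) + D (z ^ n *\<^sub>C ?a n))) sums (z *\<^sub>C Y)"
    unfolding Y_def
    by (intro bounded_linear.sums[OF bounded_linear_scaleC] sums_add sums_op[OF Ta X]
        sums_op[OF bounded_clinear_defect_op hardy_fun_sums[OF z]])
  then have "(\<lambda>n. z ^ Suc n *\<^sub>C ?x (Suc n)) sums (z *\<^sub>C Y)"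
    by (simp add: lin scaleC_scaleC scaleC_add_right)
  then have "(\<lambda>n. z ^ n *\<^sub>C ?x n) sums (z *\<^sub>C Y)"
    using sums_Suc_iff[of "\<lambda>n. z ^ n *\<^sub>C ?x n" "z *\<^sub>C Y"] by simp
  then have XY: "X = z *\<^sub>C Y"
    using X sums_unique2 by blast
  then have "Y - z *\<^sub>C Ta Y = D (hardy_fun f z)"
    by (subst (1) Y_def) (simp add: lin)
  then have "char_fun T z (hardy_fun f z) = Da X - T (hardy_fun f z)"
    unfolding char_fun_def by (simp add: resolvent_eq[OF z] XY lin)
  then show "(\<lambda>n. z ^ n *\<^sub>C ?b n) sums char_fun T z (hardy_fun f z)"
    using sums_diff[OF sums_op[OF adj.bounded_clinear_defect_op X] sums_op[OF T hardy_fun_sums[OF z]]]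
    by (simp add: lin scaleC_diff_right)
qed

text \<open>The adjoint system runs backwards in time, with \<open>g\<close> as input and \<open>u\<close> as states; its outputs
  \<open>D u\<^sub>n\<^sub>+\<^sub>1 - T\<^sup>* g\<^sub>n\<close> are the coefficients of the adjoint multiplication operator applied to \<open>g\<close>.
  Summing the adjoint relation over time leaves the boundary term \<open>\<langle>x\<^sub>N, u\<^sub>N\<rangle>\<close>, which tends to 0 since
  the states \<open>x\<^sub>N\<close> are bounded and \<open>u\<^sub>N\<close> tends to 0.\<close>

lemma cinner_char_mult_sums:
  fixes f g :: "'a hardy"
  assumes u: "\<And>n. u n = T (u (Suc n)) + Da (taylor g n)" and lim: "u \<longlonglongrightarrow> 0"
  shows "(\<lambda>n. cinner (taylor f n) (D (u (Suc n)) - Ta (taylor g n)))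
    sums cinner (hardy_mult (char_fun T) f) g"
proof -
  let ?b = "taylor (hardy_mult (char_fun T) f)" and ?x = "state (taylor f)"
  let ?v = "\<lambda>n. D (u (Suc n)) - Ta (taylor g n)"
  have step: "cinner (?x (Suc n)) (u (Suc n)) + cinner (?b n) (taylor g n)
      = cinner (?x n) (u n) + cinner (taylor f n) (?v n)" for n
    using colligation_adjoint[of "?x n" "taylor f n" "u (Suc n)" "taylor g n"] u[of n]
    by (simp add: taylor_char_mult)
  have partial: "(\<Sum>n<N. cinner (taylor f n) (?v n))
      = (\<Sum>n<N. cinner (?b n) (taylor g n)) + cinner (?x N) (u N)" for N
  proof (induction N)
    case (Suc N)
    then show ?case using step[of N] by (simp add: algebra_simps)
  qed simp
  have "(\<lambda>N. cinner (?x N) (u N)) \<longlonglongrightarrow> 0"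
  proof (rule Lim_null_comparison)
    have "norm (cinner (?x N) (u N)) \<le> norm f * norm (u N)" for N
      using norm_cinner_le[of "?x N" "u N"] mult_right_mono[OF norm_state_le[of f N] norm_ge_zero[of "u N"]]
      by linarith
    then show "\<forall>\<^sub>F N in sequentially. norm (cinner (?x N) (u N)) \<le> norm f * norm (u N)"
      by simp
    show "(\<lambda>N. norm f * norm (u N)) \<longlonglongrightarrow> 0"
      using lim by (auto intro!: tendsto_eq_intros)
  qed
  from tendsto_add[OF cinner_hardy_sums[unfolded sums_def] this]
  show ?thesis
    unfolding sums_def partial by simp
qed

end

section \<open>The functional model of a pure contraction\<close>

lemma ex_taylor_tail: "\<exists>h. taylor h = (\<lambda>k. taylor g (k + n))" for g :: "'a::chilbert_space hardy"
  using summable_ignore_initial_segment[OF square_summable_taylor[of g, unfolded square_summable_def]]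
  by (intro ex_hardy) (simp add: square_summable_def)

definition taylor_tail :: "nat \<Rightarrow> 'a::chilbert_space hardy \<Rightarrow> 'a hardy" where
  "taylor_tail n g = (SOME h. taylor h = (\<lambda>k. taylor g (k + n)))"

lemma taylor_taylor_tail: "taylor (taylor_tail n g) = (\<lambda>k. taylor g (k + n))"
  unfolding taylor_tail_def using ex_taylor_tail by (rule someI_ex)

lemma LIMSEQ_norm_taylor_tail: "(\<lambda>n. norm (taylor_tail n g)) \<longlonglongrightarrow> 0"
proof -
  have "(norm (taylor_tail n g))\<^sup>2 = (norm g)\<^sup>2 - (\<Sum>k<n. (norm (taylor g k))\<^sup>2)" for n
    using sums_split_initial_segment[OF norm_hardy_sums[of g], of n]
      norm_hardy_sums[of "taylor_tail n g"] unfolding taylor_taylor_tail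
    by (rule sums_unique2[rotated])
  moreover have "(\<lambda>n. (norm g)\<^sup>2 - (\<Sum>k<n. (norm (taylor g k))\<^sup>2)) \<longlonglongrightarrow> (norm g)\<^sup>2 - (norm g)\<^sup>2"
    by (intro tendsto_intros norm_hardy_sums[unfolded sums_def])
  ultimately have "(\<lambda>n. sqrt ((norm (taylor_tail n g))\<^sup>2)) \<longlonglongrightarrow> sqrt 0"
    by (intro tendsto_real_sqrt) simp
  then show ?thesis by simp
qed

locale pure_contraction_op = contraction_op +
  assumes pure: "(\<lambda>n. (Ta ^^ n) x) \<longlonglongrightarrow> 0"
begin

lemma bounded_clinear_adj_funpow: "bounded_clinear (Ta ^^ n)"
proof (rule bounded_clinearI[where K = 1])
  show "norm ((Ta ^^ n) x) \<le> 1 * norm x" for x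
    by (induction n) (use Ta_le order_trans in auto)
  show "(Ta ^^ n) (x + y) = (Ta ^^ n) x + (Ta ^^ n) y" "(Ta ^^ n) (c *\<^sub>C x) = c *\<^sub>C (Ta ^^ n) x" for x y c
    by (induction n) (simp_all add: bounded_clinear_simps[OF Ta])
qed

lemma defect_orbit_sums:
  "(\<lambda>n. cinner (Da ((Ta ^^ n) h)) (Da ((Ta ^^ n) k))) sums cinner h k"
proof -
  let ?s = "\<lambda>n. cinner ((Ta ^^ n) h) ((Ta ^^ n) k)"
  have "?s \<longlonglongrightarrow> 0"
  proof (rule Lim_null_comparison)
    show "\<forall>\<^sub>F n in sequentially. norm (?s n) \<le> norm ((Ta ^^ n) h) * norm ((Ta ^^ n) k)"
      by (simp add: norm_cinner_le)
    show "(\<lambda>n. norm ((Ta ^^ n) h) * norm ((Ta ^^ n) k)) \<longlonglongrightarrow> 0"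
      using tendsto_mult[OF tendsto_norm[OF pure[of h]] tendsto_norm[OF pure[of k]]] by simp
  qed
  from telescope_sums'[OF this]
  have "(\<lambda>n. ?s n - ?s (Suc n)) sums cinner h k" by simp
  moreover have "?s n - ?s (Suc n) = cinner (Da ((Ta ^^ n) h)) (Da ((Ta ^^ n) k))" for n
    by (simp add: adj.defect_op_selfadjoint adj.defect_op_square cinner_diff_right cinner_adj'[OF T])
  ultimately show ?thesis by simp
qed

text \<open>The observability map of the system: its values are the outputs of the undriven system started at
  \<open>h\<close>.\<close>

definition obs :: "'a \<Rightarrow> 'a hardy" where
  "obs h = (SOME f. taylor f = (\<lambda>n. Da ((Ta ^^ n) h)))"

lemma taylor_obs: "taylor (obs h) = (\<lambda>n. Da ((Ta ^^ n) h))"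
proof -
  have "summable (\<lambda>n. (norm (Da ((Ta ^^ n) h)))\<^sup>2)"
    using bounded_linear.sums[OF bounded_linear_Re defect_orbit_sums[of h h]]
    by (auto simp: cinner_self summable_def)
  then have "\<exists>f. taylor f = (\<lambda>n. Da ((Ta ^^ n) h))"
    by (intro ex_hardy) (simp add: square_summable_def)
  then show ?thesis
    unfolding obs_def by (rule someI_ex)
qed

lemma cinner_obs: "cinner (obs h) (obs k) = cinner h k"
  using cinner_hardy_sums[of "obs h" "obs k"] defect_orbit_sums[of h k]
  unfolding taylor_obs by (rule sums_unique2)

lemma norm_obs: "norm (obs h) = norm h"
  using arg_cong[OF cinner_obs[of h h], of Re] by (simp add: cinner_self)

lemma obs_add: "obs (h + k) = obs h + obs k"
  by (simp flip: taylor_inject add: taylor_add taylor_obs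
      bounded_clinear_simps[OF bounded_clinear_adj_funpow]
      bounded_clinear_simps[OF adj.bounded_clinear_defect_op])

lemma obs_scaleC: "obs (c *\<^sub>C h) = c *\<^sub>C obs h"
  by (simp flip: taylor_inject add: taylor_scaleC taylor_obs
      bounded_clinear_simps[OF bounded_clinear_adj_funpow]
      bounded_clinear_simps[OF adj.bounded_clinear_defect_op])

lemma obs_diff: "obs (h - k) = obs h - obs k"
  by (simp flip: taylor_inject add: taylor_diff taylor_obs
      bounded_clinear_simps[OF bounded_clinear_adj_funpow]
      bounded_clinear_simps[OF adj.bounded_clinear_defect_op])

lemma obs_in_hardy_on: "obs h \<in> hardy_on (defect_space Ta)"
  by (simp add: hardy_on_iff_taylor[OF adj.closed_csubspace_defect_space] taylor_obs adj.defect_op_in)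

text \<open>The vector \<open>u\<close> is the adjoint of \<open>obs\<close> applied to \<open>g\<close>; \<^const>\<open>adj\<close> covers only maps of a space to
  itself.\<close>

lemma ex_obs_adj: "\<exists>u. (\<forall>h. cinner (obs h) g = cinner h u) \<and> norm u \<le> norm g"
proof -
  have "\<exists>u\<in>UNIV. \<forall>h\<in>UNIV. cinner (obs h) g = cinner h u"
  proof (rule riesz_on)
    show "norm (cinner (obs h) g) \<le> norm g * norm h" for h
      using norm_cinner_le[of "obs h" g] by (simp add: norm_obs mult.commute)
  qed (simp_all add: obs_add obs_scaleC cinner_simps)
  then obtain u where u: "\<And>h. cinner (obs h) g = cinner h u" by blast
  have "(norm u)\<^sup>2 = norm (cinner (obs u) g)"
    by (simp add: u cinner_self norm_power)
  also have "\<dots> \<le> norm u * norm g"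
    using norm_cinner_le[of "obs u" g] by (simp add: norm_obs)
  finally have "norm u * norm u \<le> norm u * norm g"
    by (simp add: power2_eq_square)
  then have "norm u \<le> norm g"
    by (cases "norm u = 0") (simp_all add: mult_le_cancel_left)
  then show ?thesis using u by blast
qed

text \<open>The orbit \<open>T\<^sup>*\<^sup>n h\<close> is a trajectory of the adjoint system with output 0, as \<open>D T\<^sup>* = T\<^sup>* D\<^sub>*\<close>.\<close>

lemma obs_orthogonal_char_mult: "cinner (obs h) (hardy_mult (char_fun T) f) = 0"
proof -
  have "(\<lambda>n. cinner (taylor f n) (D ((Ta ^^ Suc n) h) - Ta (taylor (obs h) n)))
      sums cinner (hardy_mult (char_fun T) f) (obs h)"
    by (rule cinner_char_mult_sums[OF _ pure]) (simp add: taylor_obs adj.defect_op_square)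
  then have "(\<lambda>n. 0) sums cinner (hardy_mult (char_fun T) f) (obs h)"
    by (simp add: taylor_obs adj_defect_intertwines)
  then have "cinner (hardy_mult (char_fun T) f) (obs h) = 0"
    using sums_zero by (rule sums_unique2)
  then show ?thesis
    by (metis cinner_commute complex_cnj_zero)
qed

text \<open>The vectors \<open>u\<^sub>n\<close>, the adjoint of \<open>obs\<close> applied to the tails of \<open>g\<close>, satisfy the recursion of the
  adjoint system with input \<open>g\<close>. Testing orthogonality on monomials shows that its outputs vanish. As the block operator
  is unitary, \<open>(u\<^sub>n, 0)\<close> is then mapped to \<open>(u\<^sub>n\<^sub>+\<^sub>1, g\<^sub>n)\<close>, that is \<open>u\<^sub>n\<^sub>+\<^sub>1 = T\<^sup>* u\<^sub>n\<close> and
  \<open>g\<^sub>n = D\<^sub>* u\<^sub>n\<close>; so \<open>g\<close> is the image of \<open>u\<^sub>0\<close>.\<close>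

lemma orthogonal_char_mult_imp_obs:
  assumes g: "g \<in> hardy_on (defect_space Ta)"
    and orth: "\<And>f. f \<in> hardy_on (defect_space T) \<Longrightarrow> cinner g (hardy_mult (char_fun T) f) = 0"
  shows "g \<in> range obs"
proof -
  have "\<exists>u. \<forall>n. (\<forall>h. cinner (obs h) (taylor_tail n g) = cinner h (u n)) \<and>
      norm (u n) \<le> norm (taylor_tail n g)"
    using ex_obs_adj by (intro choice allI)
  then obtain u where u: "\<And>n h. cinner (obs h) (taylor_tail n g) = cinner h (u n)"
    and u_le: "\<And>n. norm (u n) \<le> norm (taylor_tail n g)"
    by blast
  have lim: "u \<longlonglongrightarrow> 0"
    using u_le by (intro Lim_null_comparison[OF _ LIMSEQ_norm_taylor_tail[of g]]) simp
  have rec: "u n = T (u (Suc n)) + Da (taylor g n)" for n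
  proof (rule cinner_eqI_right)
    fix h
    let ?c = "\<lambda>k. cinner (Da ((Ta ^^ k) h)) (taylor g (k + n))"
    have "(\<lambda>k. ?c (Suc k)) sums cinner (Ta h) (u (Suc n))"
      using cinner_hardy_sums[of "obs (Ta h)" "taylor_tail (Suc n) g"]
      by (simp add: taylor_obs taylor_taylor_tail u funpow_swap1)
    then have "?c sums (cinner (Ta h) (u (Suc n)) + ?c 0)"
      by (rule sums_Suc)
    moreover have "?c sums cinner h (u n)"
      using cinner_hardy_sums[of "obs h" "taylor_tail n g"]
      by (simp add: taylor_obs taylor_taylor_tail u)
    ultimately have "cinner h (u n) = cinner (Ta h) (u (Suc n)) + ?c 0"
      by (rule sums_unique2[rotated])
    then show "cinner h (u n) = cinner h (T (u (Suc n)) + Da (taylor g n))"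
      by (simp add: cinner_add_right cinner_adj'[OF T] adj.defect_op_selfadjoint)
  qed
  define v where "v n = D (u (Suc n)) - Ta (taylor g n)" for n
  have v_in: "v n \<in> defect_space T" for n
    using g closed_csubspaceD(7)[OF closed_csubspace_defect_space defect_op_in adj_maps_defect_space]
    by (simp add: v_def hardy_on_iff_taylor[OF adj.closed_csubspace_defect_space])
  have v0: "v m = 0" for m
  proof -
    have "square_summable (\<lambda>n. if n = m then v m else 0)"
      unfolding square_summable_def by (rule summable_finite[of "{m}"]) auto
    then obtain f where f: "taylor f = (\<lambda>n. if n = m then v m else 0)"
      using ex_hardy by blast
    have "f \<in> hardy_on (defect_space T)"
      using v_in closed_csubspaceD(2)[OF closed_csubspace_defect_space]
      by (simp add: hardy_on_iff_taylor[OF closed_csubspace_defect_space] f)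
    then have "cinner (hardy_mult (char_fun T) f) g = 0"
      by (metis orth cinner_commute complex_cnj_zero)
    then have "(\<lambda>n. cinner (taylor f n) (v n)) sums 0"
      using cinner_char_mult_sums[OF rec lim, of f] by (simp add: v_def)
    moreover have "(\<lambda>n. cinner (taylor f n) (v n)) sums cinner (v m) (v m)"
      using sums_single[of m "\<lambda>n. cinner (v n) (v n)"]
      by (rule back_subst[of "\<lambda>s. s sums _"]) (auto simp: f)
    ultimately have "cinner (v m) (v m) = 0"
      by (rule sums_unique2[rotated])
    then show ?thesis by simp
  qed
  have "u (Suc n) = Ta (u n)" "taylor g n = Da (u n)" for n
    using colligation_coisometric[of "u (Suc n)" "taylor g n"] v0[of n] rec[of n]
    by (simp_all add: v_def bounded_clinear_simps[OF T] bounded_clinear_simps[OF bounded_clinear_defect_op])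
  then have "taylor g n = Da ((Ta ^^ n) (u 0))" for n
  proof -
    have "u n = (Ta ^^ n) (u 0)"
      by (induction n) (simp_all add: \<open>\<And>n. u (Suc n) = Ta (u n)\<close>)
    then show ?thesis using \<open>\<And>n. taylor g n = Da (u n)\<close> by simp
  qed
  then have "taylor g = taylor (obs (u 0))"
    by (simp add: taylor_obs fun_eq_iff)
  then have "g = obs (u 0)"
    by (simp add: taylor_inject)
  then show ?thesis
    by simp
qed

lemma model_space_eq_range_obs: "model_space T = range obs"
proof (intro set_eqI iffI)
  fix g
  assume "g \<in> model_space T"
  then show "g \<in> range obs"
    unfolding model_space_def orth_diff_def by (intro orthogonal_char_mult_imp_obs) simp_all
next
  fix g
  assume "g \<in> range obs"
  then show "g \<in> model_space T"
    unfolding model_space_def orth_diff_def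
    by (elim rangeE) (simp add: obs_in_hardy_on obs_orthogonal_char_mult)
qed

lemma unitary_obs: "unitary_between UNIV (model_space T) obs"
  unfolding unitary_between_def model_space_eq_range_obs
  by (intro conjI ballI allI refl obs_add obs_scaleC cinner_obs)

lemma orth_proj_model_space_eq:
  assumes S: "bounded_clinear S" and "\<And>k. cinner F (obs k) = cinner h (adj S k)"
  shows "orth_proj (model_space T) F = obs (S h)"
  unfolding model_space_eq_range_obs
proof (rule orth_proj_eqI)
  show "cinner (F - obs (S h)) s = 0" if s: "s \<in> range obs" for s
  proof -
    obtain k where "s = obs k" using s by blast
    then show ?thesis
      by (simp add: cinner_diff_left assms(2) cinner_obs cinner_adj[OF S])
  qed
  show "s - t \<in> range obs" if st: "s \<in> range obs" "t \<in> range obs" for s t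
  proof -
    obtain a b where "s = obs a" "t = obs b" using st by blast
    then have "s - t = obs (a - b)" by (simp add: obs_diff)
    then show ?thesis by simp
  qed
qed simp

lemma bounded_clinear_on_identity: "bounded_clinear_on (defect_space Ta) (\<lambda>v. v)"
  by (auto simp: bounded_clinear_on_def intro: exI[of _ 1])

lemma compression_shift: "compression (model_space T) (shift_tensor (\<lambda>v. v)) (obs h) = obs (T h)"
  unfolding compression_def
proof (rule orth_proj_model_space_eq[OF T])
  fix k
  let ?F = "shift_tensor (\<lambda>v. v) (obs h)"
  have "(\<lambda>n. cinner (taylor ?F (Suc n)) (taylor (obs k) (Suc n))) sums cinner (obs h) (obs (Ta k))"
    using cinner_hardy_sums[of "obs h" "obs (Ta k)"]
    by (simp add: taylor_shift_tensor[OF adj.closed_csubspace_defect_space bounded_clinear_on_identity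
          obs_in_hardy_on] taylor_obs funpow_swap1)
  from sums_Suc[OF this] have "(\<lambda>n. cinner (taylor ?F n) (taylor (obs k) n)) sums cinner h (Ta k)"
    by (simp add: taylor_shift_tensor[OF adj.closed_csubspace_defect_space bounded_clinear_on_identity
          obs_in_hardy_on] cinner_obs)
  with cinner_hardy_sums show "cinner ?F (obs k) = cinner h (Ta k)"
    by (rule sums_unique2)
qed

text \<open>The equation for \<open>D\<^sub>* S\<^sup>*\<close>, applied at \<open>T\<^sup>*\<^sup>n k\<close>, matches the coefficients of \<open>obs (S\<^sup>* k)\<close> with
  those of the adjoint of \<open>I \<otimes> B\<^sup>* + M\<^sub>z \<otimes> A\<close> applied to \<open>obs k\<close>; the shift in \<open>M\<^sub>z\<close> accounts for
  the additional factor \<open>T\<^sup>*\<close>.\<close>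

lemma compression_pencil:
  assumes S: "bounded_clinear S" and comm: "\<And>x. adj S (Ta x) = Ta (adj S x)"
    and A: "bounded_clinear_on (defect_space Ta) A" and B: "bounded_clinear_on (defect_space Ta) B"
    and eq: "\<And>x. Da (adj S x) = B (Da x) + adj_on (defect_space Ta) A (Da (Ta x))"
  shows "compression (model_space T)
      (\<lambda>f. id_tensor (adj_on (defect_space Ta) B) f + shift_tensor A f) (obs h) = obs (S h)"
  unfolding compression_def
proof (rule orth_proj_model_space_eq[OF S])
  fix k
  let ?E = "defect_space Ta"
  let ?F = "id_tensor (adj_on ?E B) (obs h)" and ?G = "shift_tensor A (obs h)"
  let ?h = "\<lambda>n. Da ((Ta ^^ n) h)" and ?k = "\<lambda>n. Da ((Ta ^^ n) k)"
  note E = adj.closed_csubspace_defect_space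
  have B': "cinner (adj_on ?E B x) y = cinner x (B y)" if "y \<in> ?E" for x y
    using adj_on_props(2)[OF E B that, of x] by (metis cinner_commute)
  have A': "cinner (A x) y = cinner x (adj_on ?E A y)" if "x \<in> ?E" for x y
    using adj_on_props(2)[OF E A that] .
  have "(\<lambda>n. cinner (?h n) (B (?k n))) sums cinner ?F (obs k)"
    using cinner_hardy_sums[of ?F "obs k"]
    by (simp add: taylor_id_tensor[OF E bounded_clinear_on_adj_on[OF E B] obs_in_hardy_on]
        taylor_obs B' adj.defect_op_in)
  moreover have "(\<lambda>n. cinner (?h n) (adj_on ?E A (?k (Suc n)))) sums cinner ?G (obs k)"
    using sums_split_initial_segment[OF cinner_hardy_sums[of ?G "obs k"], of 1]
    by (simp add: taylor_shift_tensor[OF E A obs_in_hardy_on] taylor_obs A' adj.defect_op_in)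
  ultimately have "(\<lambda>n. cinner (?h n) (B (?k n) + adj_on ?E A (?k (Suc n))))
      sums (cinner ?F (obs k) + cinner ?G (obs k))"
    unfolding cinner_add_right by (rule sums_add)
  moreover have "B (?k n) + adj_on ?E A (?k (Suc n)) = Da ((Ta ^^ n) (adj S k))" for n
  proof -
    have "adj S ((Ta ^^ n) k) = (Ta ^^ n) (adj S k)"
      by (induction n) (simp_all add: comm)
    then show ?thesis
      using eq[of "(Ta ^^ n) k"] by simp
  qed
  ultimately have "(\<lambda>n. cinner (?h n) (Da ((Ta ^^ n) (adj S k)))) sums cinner (?F + ?G) (obs k)"
    by (simp add: cinner_add_left)
  then show "cinner (?F + ?G) (obs k) = cinner h (adj S k)"
    using defect_orbit_sums by (rule sums_unique2)
qed

end

section \<open>Fundamental operators and tetrablock contractions\<close>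

text \<open>The difference \<open>w\<close> of the two sides lies in the defect space, where \<open>D\<close> is injective. Applied to
  \<open>w\<close>, \<open>D\<close> produces \<open>D\<^sup>2 = I - T\<^sup>* T\<close>, \<open>D A\<^sub>1 D\<close> and \<open>D A\<^sub>2\<^sup>* D = (D A\<^sub>2 D)\<^sup>*\<close>, and by the
  defining equations these cancel.\<close>

lemma (in contraction_op) fundamental_operators_intertwine:
  assumes S1: "bounded_clinear S1" and S2: "bounded_clinear S2"
    and comm: "\<And>x. S1 (T x) = T (S1 x)"
    and fund: "fundamental_operators S1 S2 T A1 A2"
  shows "D (S1 x) = A1 (D x) + adj_on (defect_space T) A2 (D (T x))"
proof -
  let ?E = "defect_space T" and ?B = "adj_on (defect_space T) A2"
  note E = closed_csubspace_defect_space
  note lin = bounded_clinear_simps[OF bounded_clinear_defect_op]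
  have A: "bounded_clinear_on ?E A1" "bounded_clinear_on ?E A2"
    and eq1: "D (A1 (D x)) = S1 x - adj S2 (T x)" and eq2: "D (A2 (D x)) = S2 x - adj S1 (T x)" for x
    using fund unfolding fundamental_operators_def by auto
  have DB: "D (?B (D y)) = adj S2 y - Ta (S1 y)" for y
  proof (rule cinner_eqI_right)
    fix k
    have "cinner k (D (?B (D y))) = cinner (D k) (?B (D y))"
      by (rule defect_op_selfadjoint[symmetric])
    also have "\<dots> = cinner (A2 (D k)) (D y)"
      by (rule adj_on_props(2)[OF E A(2) defect_op_in, symmetric])
    also have "\<dots> = cinner (D (A2 (D k))) y"
      by (rule defect_op_selfadjoint[symmetric])
    also have "\<dots> = cinner k (adj S2 y - Ta (S1 y))"
      by (simp add: eq2 cinner_simps cinner_adj'[OF S1] cinner_adj[OF S2] cinner_adj[OF T])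
    finally show "cinner k (D (?B (D y))) = cinner k (adj S2 y - Ta (S1 y))" .
  qed
  define w where "w = D (S1 x) - A1 (D x) - ?B (D (T x))"
  have "D w = 0"
    by (simp add: w_def lin defect_op_square eq1 DB comm)
  moreover have "A1 (D x) \<in> ?E"
    using A(1) defect_op_in unfolding bounded_clinear_on_def by blast
  then have "w \<in> ?E"
    unfolding w_def
    by (rule closed_csubspaceD(7)[OF E closed_csubspaceD(7)[OF E defect_op_in]
          adj_on_props(1)[OF E A(2)]])
  ultimately have "w = 0"
    by (rule defect_op_inj_on[rotated])
  then show ?thesis
    by (simp add: w_def algebra_simps)
qed

lemma fundamental_operators_swap:
  "fundamental_operators S1 S2 S3 A1 A2 \<Longrightarrow> fundamental_operators S2 S1 S3 A2 A1"
  by (simp add: fundamental_operators_def)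

lemma tetrablock_swap: "(x1, x2, x3) \<in> tetrablock \<Longrightarrow> (x2, x1, x3) \<in> tetrablock"
proof -
  assume *: "(x1, x2, x3) \<in> tetrablock"
  have "1 - z * x2 - w * x1 + z * w * x3 \<noteq> 0" if "norm z \<le> 1 \<and> norm w \<le> 1" for z w
  proof -
    have "1 - w * x1 - z * x2 + w * z * x3 \<noteq> 0"
      using * that unfolding tetrablock_def by blast
    then show ?thesis by (simp add: algebra_simps)
  qed
  then show ?thesis unfolding tetrablock_def by blast
qed

text \<open>As a function of \<open>w\<close> the polynomial is affine with constant term \<open>1 - z x\<^sub>1\<close> and slope
  \<open>-(x\<^sub>2 - z x\<^sub>3)\<close>, so if the inequality failed it would have a zero in the closed disc.\<close>

lemma tetrablock_norm_less:
  assumes "(x1, x2, x3) \<in> tetrablock" and z: "norm z \<le> 1"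
  shows "norm (x2 - z * x3) < norm (1 - z * x1)"
proof (rule ccontr)
  have nz: "1 - z * x1 - w * x2 + z * w * x3 \<noteq> 0" if "norm w \<le> 1" for w
    using assms that unfolding tetrablock_def by blast
  assume "\<not> ?thesis"
  then have le: "norm (1 - z * x1) \<le> norm (x2 - z * x3)" by simp
  define w where "w = (1 - z * x1) / (x2 - z * x3)"
  have "x2 - z * x3 \<noteq> 0"
    using le nz[of 0] by auto
  then have "norm w \<le> 1" "w * (x2 - z * x3) = 1 - z * x1"
    using le by (simp_all add: w_def norm_divide)
  then show False
    using nz[of w] by (simp add: algebra_simps)
qed

text \<open>Adding the squared inequalities for \<open>z = 1\<close> and \<open>z = -1\<close> removes the cross terms and leaves
  \<open>\<bar>x\<^sub>2\<bar>\<^sup>2 + \<bar>x\<^sub>3\<bar>\<^sup>2 \<le> 1 + \<bar>x\<^sub>1\<bar>\<^sup>2\<close>; adding the same with \<open>x\<^sub>1\<close> and \<open>x\<^sub>2\<close> exchanged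
  isolates \<open>x\<^sub>3\<close>.\<close>

lemma norm_third_tetrablock_le:
  assumes x: "(x1, x2, x3) \<in> tetrablock"
  shows "norm x3 \<le> 1"
proof -
  have para: "(norm (a - b))\<^sup>2 + (norm (a + b))\<^sup>2 = 2 * (norm a)\<^sup>2 + 2 * (norm b)\<^sup>2" for a b :: complex
    unfolding power2_norm_eq_inner
    by (simp add: inner_add_left inner_add_right inner_diff_left inner_diff_right inner_commute)
  note less = tetrablock_norm_less[OF x] tetrablock_norm_less[OF tetrablock_swap[OF x]]
  have "(norm (x2 - x3))\<^sup>2 \<le> (norm (1 - x1))\<^sup>2" "(norm (x2 + x3))\<^sup>2 \<le> (norm (1 + x1))\<^sup>2"
    "(norm (x1 - x3))\<^sup>2 \<le> (norm (1 - x2))\<^sup>2" "(norm (x1 + x3))\<^sup>2 \<le> (norm (1 + x2))\<^sup>2"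
    using less(1)[of 1] less(1)[of "-1"] less(2)[of 1] less(2)[of "-1"]
    by (auto intro!: power_mono)
  then have "(norm x3)\<^sup>2 \<le> 1"
    using para[of x2 x3] para[of 1 x1] para[of x1 x3] para[of 1 x2]
    unfolding norm_one power_one by linarith
  then show ?thesis
    by (simp add: abs_square_le_1)
qed

lemma E_contraction_third:
  assumes "E_contraction S1 S2 S3"
  shows "contraction_op S3"
proof
  show S3: "bounded_clinear S3"
    using assms unfolding E_contraction_def by blast
  \<comment> \<open>The coefficients of the polynomial \<open>x\<^sub>3\<close>.\<close>
  define c :: "nat \<Rightarrow> nat \<Rightarrow> nat \<Rightarrow> complex" where "c i j k = (if i = 0 \<and> j = 0 \<and> k = 1 then 1 else 0)" for i j k
  have "poly3_op 1 c S1 S2 S3 = S3"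
    by (rule ext) (simp add: poly3_op_def c_def)
  moreover have "norm (poly3 1 c x) = norm (snd (snd x))" for x
    by (cases x) (simp add: poly3_def c_def)
  moreover have "onorm (poly3_op 1 c S1 S2 S3) \<le> (SUP x\<in>closure tetrablock. norm (poly3 1 c x))"
    using assms unfolding E_contraction_def by blast
  ultimately have "onorm S3 \<le> (SUP x\<in>closure tetrablock. norm (snd (snd x)))"
    by simp
  also have "\<dots> \<le> 1"
  proof (rule cSUP_least)
    have "(0, 0, 0) \<in> tetrablock" by (simp add: tetrablock_def)
    then show "closure tetrablock \<noteq> {}" using closure_subset by blast
    have "closed {x :: complex \<times> complex \<times> complex. norm (snd (snd x)) \<le> 1}"
      by (intro closed_Collect_le continuous_intros)
    moreover have "tetrablock \<subseteq> {x. norm (snd (snd x)) \<le> 1}"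
      using norm_third_tetrablock_le by auto
    ultimately have "closure tetrablock \<subseteq> {x. norm (snd (snd x)) \<le> 1}"
      by (rule closure_minimal[rotated])
    then show "norm (snd (snd x)) \<le> 1" if "x \<in> closure tetrablock" for x
      using that by blast
  qed
  finally have "onorm S3 \<le> 1" .
  then show "norm (S3 x) \<le> norm x" for x
    using onorm[OF bounded_clinear_imp_bounded_linear[OF S3], of x]
      mult_right_mono[of "onorm S3" 1 "norm x"] by simp
qed

lemma adj_commute:
  fixes S T :: "'a::chilbert_space \<Rightarrow> 'a"
  assumes S: "bounded_clinear S" and T: "bounded_clinear T" and "S \<circ> T = T \<circ> S"
  shows "adj S (adj T x) = adj T (adj S x)"
proof (rule cinner_eqI_right)
  fix z
  have "T (S z) = S (T z)" using assms(3) by (metis comp_apply)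
  then show "cinner z (adj S (adj T x)) = cinner z (adj T (adj S x))"
    by (simp flip: cinner_adj[OF S] cinner_adj[OF T])
qed

theorem theorem3p4:
  fixes T1 T2 T A1 A2 :: "'a::chilbert_space \<Rightarrow> 'a"
  assumes "pure_E_contraction T1 T2 T"
    and "fundamental_operators (adj T1) (adj T2) (adj T) A1 A2"
    and "\<forall>x\<in>defect_space (adj T). commutator A1 A2 x = 0"
    and "\<forall>x\<in>defect_space (adj T).
      commutator (adj_on (defect_space (adj T)) A1) A1 x =
      commutator (adj_on (defect_space (adj T)) A2) A2 x"
  shows "unitarily_equivalent3
    UNIV (T1, T2, T)
    (model_space T)
      (compression (model_space T)
         (\<lambda>f. id_tensor (adj_on (defect_space (adj T)) A1) f + shift_tensor A2 f),
       compression (model_space T)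
         (\<lambda>f. id_tensor (adj_on (defect_space (adj T)) A2) f + shift_tensor A1 f),
       compression (model_space T) (shift_tensor (\<lambda>v. v)))"
proof -
  have E: "E_contraction T1 T2 T"
    using assms(1) by (simp add: pure_E_contraction_def)
  then interpret contraction_op T
    by (rule E_contraction_third)
  interpret pure_contraction_op T
    using assms(1) by unfold_locales (simp add: pure_E_contraction_def)
  have T12: "bounded_clinear T1" "bounded_clinear T2" and comm: "T1 \<circ> T = T \<circ> T1" "T2 \<circ> T = T \<circ> T2"
    using E unfolding E_contraction_def by auto
  have A: "bounded_clinear_on (defect_space Ta) A1" "bounded_clinear_on (defect_space Ta) A2"
    using assms(2) unfolding fundamental_operators_def by auto
  note adj_comm = adj_commute[OF T12(1) T comm(1)] adj_commute[OF T12(2) T comm(2)]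
  note intertwine =
    adj.fundamental_operators_intertwine[OF bounded_clinear_adj[OF T12(1)]
      bounded_clinear_adj[OF T12(2)] adj_comm(1) assms(2)]
    adj.fundamental_operators_intertwine[OF bounded_clinear_adj[OF T12(2)]
      bounded_clinear_adj[OF T12(1)] adj_comm(2) fundamental_operators_swap[OF assms(2)]]
  have "obs (T1 h) = compression (model_space T)
      (\<lambda>f. id_tensor (adj_on (defect_space Ta) A1) f + shift_tensor A2 f) (obs h)" for h
    by (rule compression_pencil[OF T12(1) adj_comm(1) A(2) A(1) intertwine(1), symmetric])
  moreover have "obs (T2 h) = compression (model_space T)
      (\<lambda>f. id_tensor (adj_on (defect_space Ta) A2) f + shift_tensor A1 f) (obs h)" for h
    by (rule compression_pencil[OF T12(2) adj_comm(2) A(1) A(2) intertwine(2), symmetric])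
  moreover have "obs (T h) = compression (model_space T) (shift_tensor (\<lambda>v. v)) (obs h)" for h
    by (rule compression_shift[symmetric])
  ultimately show ?thesis
    unfolding unitarily_equivalent3_def prod.case using unitary_obs by blast
qed

end
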